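(* Let $(\Lambda,w,\mathscr{H},\varepsilon)$ be an input datum over $k$ and $\mathfrak{h}$ the Lie algebra constructed from it. Extend $w$ to the automorphism of $\widetilde\Lambda=\Lambda\times_{\Lambda_w}\mathscr{H}$ given by $w(\lambda,h)=(w\lambda,h)$. Define $\widetilde w:\mathfrak{h}\to\mathfrak{h}$ by setting $\widetilde w(\alpha^\vee)=w(\alpha)^\vee$ for all $\alpha\in\Phi$ and $\widetilde w(X_{\tilde\alpha})=X_{w(\tilde\alpha)}$ for all $\tilde\alpha\in\widetilde\Phi$, and extending linearly. Then $\widetilde w$ is a Lie algebra automorphism of $\mathfrak{h}$.
   Context: A lattice is a finitely generated free $\mathbb{Z}$-module $\Lambda$ with a symmetric positive-definite bilinear form $(\cdot,\cdot):\Lambda\times\Lambda\to\mathbb{Z}$; $\operatorname{Aut}(\Lambda)$ is the group of $\mathbb{Z}$-linear bijections preserving the form. $\Lambda$ is a simply laced root lattice if it is generated by its set of roots $\Phi=\{\alpha\in\Lambda : (\alpha,\alpha)=2\}$. For $\gamma\in\Lambda$, $\gamma^\vee\in\operatorname{Hom}(\Lambda,\mathbb{Z})$ is $\gamma^\vee(\alpha)=(\gamma,\alpha)$. An automorphism $w\in\operatorname{Aut}(\Lambda)$ is elliptic if the group of coinvariants $\Lambda_w=\Lambda/(1-w)\Lambda$ is finite. Setting: $\Lambda$ is a simply laced root lattice, $w$ an elliptic automorphism of $\Lambda$ of order $d$, $k$ a field of characteristic zero containing a primitive $d$th root of unity $\zeta$, and $1\to\langle\zeta\rangle\to\mathscr{H}\to\Lambda_w\to1$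 a central extension with commutator pairing $\langle\cdot,\cdot\rangle:\Lambda_w\times\Lambda_w\to\langle\zeta\rangle$. Let $\widetilde\Lambda=\Lambda\times_{\Lambda_w}\mathscr{H}$, a central extension of $\Lambda$ by $\langle\zeta\rangle$; its commutator pairing on $\Lambda$ (the pullback of that on $\Lambda_w$) is also written $\langle\cdot,\cdot\rangle$. Let $\widetilde\Phi$ be the preimage of $\Phi$ in $\widetilde\Lambda$; for $\tilde\alpha\in\widetilde\Phi$ write $\alpha$ for its image in $\Phi$. The quadruple $(\Lambda,w,\mathscr{H},\varepsilon)$ is an input datum if $\varepsilon:\Lambda\times\Lambda\to k^\times$ is bilinear (multiplicative in each variable) and: (1) $\varepsilon(\alpha,\beta)/\varepsilon(\beta,\alpha)=-\langle\beta,\alpha\rangle$ whenever $(\alpha,\beta)=-1$; (2) $\varepsilon(w\alpha,w\beta)=\varepsilon(\alpha,\beta)$ for all $\alpha,\beta\in\Lambda$. Construction of $\mathfrak{h}$: $\mathfrak{t}=\operatorname{Hom}(\Lambda,k)$, spanned by $\{\alpha^\vee:\alpha\in\Phi\}$; $\mathfrak{l}$ is the $k$-vector space generated by symbols $X_{\tilde\alpha}$, $\tilde\alpha\in\widetilde\Phi$, modulo the relations $X_{\zeta\tilde\alpha}=\zeta X_{\tilde\alpha}$; $\mathfrak{h}=\mathfrak{t}\oplus\mathfrak{l}$. It is a Lie algebra under the $k$-bilinear bracket with $[\mathfrak{t},\mathfrak{t}]=0$, $[\alpha^\vee,X_{\tilde\beta}]=-[X_{\tilde\beta},\alpha^\vee]=(\alpha,\beta)X_{\tilde\beta}$,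 and $[X_{\tilde\alpha},X_{\tilde\beta}]=\varepsilon(\alpha,\beta)\,\tilde\alpha\tilde\beta\,\alpha^\vee$ if $\alpha+\beta=0$ (with $\tilde\alpha\tilde\beta\in\langle\zeta\rangle\subset k^\times$ a scalar), $\varepsilon(\alpha,\beta)X_{\tilde\alpha\tilde\beta}$ if $\alpha+\beta\in\Phi$, and $0$ otherwise. *)

theory Defs
  imports Complex_Main "HOL-Algebra.Coset" "HOL-Library.Poly_Mapping"
begin

section \<open>Lattices\<close>

locale integral_lattice = Modules.module smul
  for smul :: "int \<Rightarrow> 'l::ab_group_add \<Rightarrow> 'l" +
  fixes form :: "'l \<Rightarrow> 'l \<Rightarrow> int"
  assumes finite_free: "\<exists>B. finite B \<and> independent B \<and> span B = UNIV"
    and form_add_left: "form (x + y) z = form x z + form y z"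
    and form_sym: "form x y = form y x"
    and form_pos_def: "x \<noteq> 0 \<Longrightarrow> form x x > 0"
begin

definition roots :: "'l set" where
  "roots = {\<alpha>. form \<alpha> \<alpha> = 2}"

definition lattice_aut :: "('l \<Rightarrow> 'l) \<Rightarrow> bool" where
  "lattice_aut f \<longleftrightarrow> module_hom smul smul f \<and> bij f \<and> (\<forall>x y. form (f x) (f y) = form x y)"

end

locale simply_laced_root_lattice = integral_lattice +
  assumes roots_generate: "span roots = UNIV"

definition additive_group :: "'l::ab_group_add monoid" where
  "additive_group = \<lparr>carrier = UNIV, mult = (+), one = 0\<rparr>"

definition coinvariants :: "('l::ab_group_add \<Rightarrow> 'l) \<Rightarrow> 'l set monoid" where
  "coinvariants w = additive_group Mod range (\<lambda>x. x - w x)"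

definition coinv_class :: "('l::ab_group_add \<Rightarrow> 'l) \<Rightarrow> 'l \<Rightarrow> 'l set" where
  "coinv_class w x = range (\<lambda>x. x - w x) #>\<^bsub>additive_group\<^esub> x"

definition elliptic :: "('l::ab_group_add \<Rightarrow> 'l) \<Rightarrow> bool" where
  "elliptic w \<longleftrightarrow> finite (carrier (coinvariants w))"

section \<open>Central extensions\<close>

definition primitive_root_of_unity :: "nat \<Rightarrow> 'k::field \<Rightarrow> bool" where
  "primitive_root_of_unity d z \<longleftrightarrow> d > 0 \<and> z ^ d = 1 \<and> (\<forall>e. 0 < e \<and> e < d \<longrightarrow> z ^ e \<noteq> 1)"

text \<open>For a root of unity, the natural powers already form the cyclic group it generates.\<close>
definition cyclic_mult_group :: "'k::field \<Rightarrow> 'k monoid" where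
  "cyclic_mult_group z = \<lparr>carrier = range (\<lambda>i::nat. z ^ i), mult = (*), one = 1\<rparr>"

definition central_extension ::
  "('a, 'ax) monoid_scheme \<Rightarrow> ('e, 'ex) monoid_scheme \<Rightarrow> ('q, 'qx) monoid_scheme \<Rightarrow>
    ('a \<Rightarrow> 'e) \<Rightarrow> ('e \<Rightarrow> 'q) \<Rightarrow> bool" where
  "central_extension A E Q \<iota> \<pi> \<longleftrightarrow>
    group A \<and> group E \<and> group Q \<and>
    \<iota> \<in> hom A E \<and> inj_on \<iota> (carrier A) \<and>
    \<pi> \<in> hom E Q \<and> \<pi> ` carrier E = carrier Q \<and>
    \<iota> ` carrier A = kernel E Q \<pi> \<and>
    (\<forall>z\<in>carrier A. \<forall>x\<in>carrier E. \<iota> z \<otimes>\<^bsub>E\<^esub> x = x \<otimes>\<^bsub>E\<^esub> \<iota> z)"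

text \<open>The pairing on an abelian quotient \<open>Q\<close>: the commutator \<open>a b a\<^sup>-\<^sup>1 b\<^sup>-\<^sup>1\<close> of arbitrary lifts.\<close>
definition commutator_pairing ::
  "('a, 'ax) monoid_scheme \<Rightarrow> ('e, 'ex) monoid_scheme \<Rightarrow>
    ('a \<Rightarrow> 'e) \<Rightarrow> ('e \<Rightarrow> 'q) \<Rightarrow> 'q \<Rightarrow> 'q \<Rightarrow> 'a" where
  "commutator_pairing A E \<iota> \<pi> x y =
    (THE z. z \<in> carrier A \<and>
      (\<forall>a\<in>carrier E. \<forall>b\<in>carrier E. \<pi> a = x \<longrightarrow> \<pi> b = y \<longrightarrow>
        \<iota> z = a \<otimes>\<^bsub>E\<^esub> b \<otimes>\<^bsub>E\<^esub> inv\<^bsub>E\<^esub> a \<otimes>\<^bsub>E\<^esub> inv\<^bsub>E\<^esub> b))"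

section \<open>Vector spaces and brackets on a carrier set\<close>

text \<open>
  The underlying set of the Lie algebra depends on the input datum, so it is a carrier set and not
  a type.
\<close>

record ('k, 'v) vec_space = "'v partial_object" +
  vadd :: "'v \<Rightarrow> 'v \<Rightarrow> 'v"
  vscale :: "'k \<Rightarrow> 'v \<Rightarrow> 'v"

record ('k, 'v) lie_alg = "('k, 'v) vec_space" +
  bracket :: "'v \<Rightarrow> 'v \<Rightarrow> 'v"

definition linear_endo :: "('k, 'v, 'x) vec_space_scheme \<Rightarrow> ('v \<Rightarrow> 'v) \<Rightarrow> bool" where
  "linear_endo V f \<longleftrightarrow>
    f \<in> carrier V \<rightarrow> carrier V \<and>
    (\<forall>x\<in>carrier V. \<forall>y\<in>carrier V. f (vadd V x y) = vadd V (f x) (f y)) \<and>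
    (\<forall>c. \<forall>x\<in>carrier V. f (vscale V c x) = vscale V c (f x))"

definition bilinear_op :: "('k, 'v, 'x) vec_space_scheme \<Rightarrow> ('v \<Rightarrow> 'v \<Rightarrow> 'v) \<Rightarrow> bool" where
  "bilinear_op V B \<longleftrightarrow>
    (\<forall>x\<in>carrier V. linear_endo V (\<lambda>y. B x y)) \<and>
    (\<forall>y\<in>carrier V. linear_endo V (\<lambda>x. B x y))"

definition lie_automorphism :: "('k, 'v, 'x) lie_alg_scheme \<Rightarrow> ('v \<Rightarrow> 'v) \<Rightarrow> bool" where
  "lie_automorphism L f \<longleftrightarrow>
    linear_endo L f \<and> bij_betw f (carrier L) (carrier L) \<and>
    (\<forall>x\<in>carrier L. \<forall>y\<in>carrier L. f (bracket L x y) = bracket L (f x) (f y))"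

abbreviation poly_scale :: "'k::field \<Rightarrow> ('a \<Rightarrow>\<^sub>0 'k) \<Rightarrow> ('a \<Rightarrow>\<^sub>0 'k)" where
  "poly_scale c \<equiv> Poly_Mapping.map ((*) c)"

section \<open>The setting\<close>

locale extension_setting = simply_laced_root_lattice smul form
  for smul :: "int \<Rightarrow> 'l::ab_group_add \<Rightarrow> 'l" and form +
  fixes w :: "'l \<Rightarrow> 'l" and d :: nat and \<zeta> :: "'k::field_char_0"
    and H :: "('g, 'x) monoid_scheme"
    and \<iota> :: "'k \<Rightarrow> 'g" and \<pi> :: "'g \<Rightarrow> 'l set"
  assumes w_aut: "lattice_aut w"
    and w_elliptic: "elliptic w"
    and w_order: "d > 0" "w ^^ d = id" "\<And>e. 0 < e \<Longrightarrow> e < d \<Longrightarrow> w ^^ e \<noteq> id"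
    and \<zeta>_primitive: "primitive_root_of_unity d \<zeta>"
    and H_extension: "central_extension (cyclic_mult_group \<zeta>) H (coinvariants w) \<iota> \<pi>"
begin

abbreviation \<mu> :: "'k set" where
  "\<mu> \<equiv> carrier (cyclic_mult_group \<zeta>)"

text \<open>The commutator pairing of \<open>H\<close>, pulled back to the lattice.\<close>
definition pairing :: "'l \<Rightarrow> 'l \<Rightarrow> 'k" where
  "pairing x y =
    commutator_pairing (cyclic_mult_group \<zeta>) H \<iota> \<pi> (coinv_class w x) (coinv_class w y)"

definition lattice_ext :: "('l \<times> 'g) monoid" where
  "lattice_ext = \<lparr>
    carrier = {(x, h). h \<in> carrier H \<and> \<pi> h = coinv_class w x},
    mult = (\<lambda>(x, g) (y, h). (x + y, g \<otimes>\<^bsub>H\<^esub> h)),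
    one = (0, \<one>\<^bsub>H\<^esub>)\<rparr>"

definition ext_incl :: "'k \<Rightarrow> 'l \<times> 'g" where
  "ext_incl z = (0, \<iota> z)"

definition ext_roots :: "('l \<times> 'g) set" where
  "ext_roots = {a \<in> carrier lattice_ext. fst a \<in> roots}"

definition w_ext :: "'l \<times> 'g \<Rightarrow> 'l \<times> 'g" where
  "w_ext = (\<lambda>(x, h). (w x, h))"

end

locale input_datum = extension_setting smul form w d \<zeta> H \<iota> \<pi>
  for smul :: "int \<Rightarrow> 'l::ab_group_add \<Rightarrow> 'l" and form and w and d
    and \<zeta> :: "'k::field_char_0" and H :: "('g, 'x) monoid_scheme" and \<iota> and \<pi> +
  fixes \<epsilon> :: "'l \<Rightarrow> 'l \<Rightarrow> 'k"
  assumes \<epsilon>_nonzero: "\<epsilon> x y \<noteq> 0"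
    and \<epsilon>_add_left: "\<epsilon> (x + y) z = \<epsilon> x z * \<epsilon> y z"
    and \<epsilon>_add_right: "\<epsilon> x (y + z) = \<epsilon> x y * \<epsilon> x z"
    and \<epsilon>_swap: "form \<alpha> \<beta> = - 1 \<Longrightarrow> \<epsilon> \<alpha> \<beta> / \<epsilon> \<beta> \<alpha> = - pairing \<beta> \<alpha>"
    and \<epsilon>_w: "\<epsilon> (w \<alpha>) (w \<beta>) = \<epsilon> \<alpha> \<beta>"
begin

definition dual_space :: "('l \<Rightarrow> 'k) set" where
  "dual_space = {f. additive f}"

definition check :: "'l \<Rightarrow> 'l \<Rightarrow> 'k" where
  "check \<gamma> = (\<lambda>x. of_int (form \<gamma> x))"

text \<open>
  The symbol space is the free vector space on \<open>ext_roots\<close> (finitely supported functions) modulo the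
  span \<open>sym_relations\<close> of the elements \<open>X\<^bsub>\<zeta>a\<^esub> - \<zeta> X\<^bsub>a\<^esub>\<close>; its elements are
  cosets.
\<close>

definition sym_relations :: "(('l \<times> 'g) \<Rightarrow>\<^sub>0 'k) set" where
  "sym_relations = module.span poly_scale
    {Poly_Mapping.single (ext_incl \<zeta> \<otimes>\<^bsub>lattice_ext\<^esub> a) 1
      - poly_scale \<zeta> (Poly_Mapping.single a 1) | a. a \<in> ext_roots}"

definition sym_class :: "(('l \<times> 'g) \<Rightarrow>\<^sub>0 'k) \<Rightarrow> (('l \<times> 'g) \<Rightarrow>\<^sub>0 'k) set" where
  "sym_class x = {x + n | n. n \<in> sym_relations}"

definition sym_space :: "(('l \<times> 'g) \<Rightarrow>\<^sub>0 'k) set set" where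
  "sym_space = sym_class ` {x. Poly_Mapping.keys x \<subseteq> ext_roots}"

definition sym_add ::
  "(('l \<times> 'g) \<Rightarrow>\<^sub>0 'k) set \<Rightarrow> (('l \<times> 'g) \<Rightarrow>\<^sub>0 'k) set \<Rightarrow> (('l \<times> 'g) \<Rightarrow>\<^sub>0 'k) set" where
  "sym_add A B = {x + y | x y. x \<in> A \<and> y \<in> B}"

text \<open>Adding the relations back makes scaling by zero give the whole zero coset.\<close>
definition sym_scale ::
  "'k \<Rightarrow> (('l \<times> 'g) \<Rightarrow>\<^sub>0 'k) set \<Rightarrow> (('l \<times> 'g) \<Rightarrow>\<^sub>0 'k) set" where
  "sym_scale c A = {poly_scale c x + n | x n. x \<in> A \<and> n \<in> sym_relations}"

definition X :: "'l \<times> 'g \<Rightarrow> (('l \<times> 'g) \<Rightarrow>\<^sub>0 'k) set" where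
  "X a = sym_class (Poly_Mapping.single a 1)"

type_synonym (in -) ('l, 'g, 'k) hvec = "('l \<Rightarrow> 'k) \<times> (('l \<times> 'g) \<Rightarrow>\<^sub>0 'k) set"

definition lie_space :: "('k, ('l, 'g, 'k) hvec) vec_space" where
  "lie_space = \<lparr>
    carrier = dual_space \<times> sym_space,
    vadd = (\<lambda>(s, A) (t, B). (\<lambda>x. s x + t x, sym_add A B)),
    vscale = (\<lambda>c (s, A). (\<lambda>x. c * s x, sym_scale c A))\<rparr>"

definition in_t :: "('l \<Rightarrow> 'k) \<Rightarrow> ('l, 'g, 'k) hvec" where
  "in_t s = (s, sym_class 0)"

definition in_l :: "(('l \<times> 'g) \<Rightarrow>\<^sub>0 'k) set \<Rightarrow> ('l, 'g, 'k) hvec" where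
  "in_l A = (\<lambda>_. 0, A)"

definition is_lie_bracket ::
  "(('l, 'g, 'k) hvec \<Rightarrow> ('l, 'g, 'k) hvec \<Rightarrow> ('l, 'g, 'k) hvec) \<Rightarrow> bool" where
  "is_lie_bracket B \<longleftrightarrow>
    bilinear_op lie_space B \<and>
    (\<forall>s\<in>dual_space. \<forall>t\<in>dual_space. B (in_t s) (in_t t) = in_t (\<lambda>_. 0)) \<and>
    (\<forall>\<alpha>\<in>roots. \<forall>b\<in>ext_roots.
      B (in_t (check \<alpha>)) (in_l (X b)) = vscale lie_space (of_int (form \<alpha> (fst b))) (in_l (X b)) \<and>
      B (in_l (X b)) (in_t (check \<alpha>)) =
        vscale lie_space (- of_int (form \<alpha> (fst b))) (in_l (X b))) \<and>
    (\<forall>a\<in>ext_roots. \<forall>b\<in>ext_roots.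
      B (in_l (X a)) (in_l (X b)) =
        (if fst a + fst b = 0 then
           vscale lie_space
             (\<epsilon> (fst a) (fst b) * the_inv_into \<mu> ext_incl (a \<otimes>\<^bsub>lattice_ext\<^esub> b))
             (in_t (check (fst a)))
         else if fst a + fst b \<in> roots then
           vscale lie_space (\<epsilon> (fst a) (fst b)) (in_l (X (a \<otimes>\<^bsub>lattice_ext\<^esub> b)))
         else in_t (\<lambda>_. 0)))"

text \<open>
  The rules determine the bracket on the carrier only; requiring \<open>undefined\<close> elsewhere makes the
  description unique.
\<close>
definition lie_bracket ::
  "('l, 'g, 'k) hvec \<Rightarrow> ('l, 'g, 'k) hvec \<Rightarrow> ('l, 'g, 'k) hvec" where
  "lie_bracket = (THE B. is_lie_bracket B \<and>
    (\<forall>x y. x \<notin> carrier lie_space \<or> y \<notin> carrier lie_space \<longrightarrow> B x y = undefined))"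

definition lie_algebra :: "('k, ('l, 'g, 'k) hvec) lie_alg" where
  "lie_algebra = vec_space.extend lie_space (lie_alg.fields lie_bracket)"

definition extends_w :: "(('l, 'g, 'k) hvec \<Rightarrow> ('l, 'g, 'k) hvec) \<Rightarrow> bool" where
  "extends_w f \<longleftrightarrow>
    linear_endo lie_algebra f \<and>
    (\<forall>\<alpha>\<in>roots. f (in_t (check \<alpha>)) = in_t (check (w \<alpha>))) \<and>
    (\<forall>a\<in>ext_roots. f (in_l (X a)) = in_l (X (w_ext a)))"

end

end

(*
  The bracket is determined by its values on the generators check alpha and X_a, so any linear map
  that permutes the generators compatibly with the structure constants respects it; epsilon, the
  form and the scalars a b (for a + b = 0) are all w-invariant. Bijectivity holds because the d-th
  iterate of the lift fixes every generator.

  Two things need an argument. First, the checks of roots span Hom(Lambda, k): orthogonalise a basis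
  of Lambda over Z (up to a positive multiple), and expand an additive s as
  SUM s(e)/(e,e) check e. Second, a bilinear bracket with the prescribed values exists: the formulas
  for the free space on the symbols, extended bilinearly, respect the relations X_{zeta a} = zeta X_a
  because zeta is central.
*)
theory Submission
  imports Defs
begin

text \<open>The bracket is a definite description, and \<open>extends_w\<close> prescribes values on
  generators only, so nothing can be evaluated until both objects have explicit models:
  \<open>br\<close> and \<open>w_lift\<close>. The obstacle is that the generators are not
  independent. The checks of roots satisfy linear relations, and the symbols over one root are
  proportional, so a formula given on generators is not automatically well defined. On the torus
  side the models avoid expansions in generators altogether: \<open>s\<close> acts on
  \<open>X b\<close> through the value of \<open>s\<close> at \<open>fst b\<close>, and
  \<open>w\<close> acts on functionals by composition with its inverse. Spanning by the checks of
  roots is then needed for uniqueness and for comparing maps, not for defining them. On the symbol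
  side the models are computed on representatives in the free space, and what remains is congruence
  modulo \<open>sym_relations\<close>.\<close>

lemma lookup_poly_scale [simp]: "Poly_Mapping.lookup (poly_scale c x) k = c * Poly_Mapping.lookup x k"
  by (simp add: map.rep_eq when_def)

lemma poly_scale_single: "poly_scale c (Poly_Mapping.single k v) = Poly_Mapping.single k (c * v)"
  by (rule poly_mapping_eqI) (simp add: lookup_single when_def)

lemma keys_poly_scale_subset: "Poly_Mapping.keys (poly_scale c x) \<subseteq> Poly_Mapping.keys x"
  by (auto simp: in_keys_iff)

section \<open>Linear extension of functions from the basis of a free vector space\<close>

interpretation poly: module "poly_scale :: 'k::field \<Rightarrow> ('a \<Rightarrow>\<^sub>0 'k) \<Rightarrow> ('a \<Rightarrow>\<^sub>0 'k)"
  by unfold_locales (auto intro!: poly_mapping_eqI simp: lookup_add algebra_simps)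

interpretation scalar: module "(*) :: 'k::field \<Rightarrow> 'k \<Rightarrow> 'k"
  by unfold_locales (auto simp: algebra_simps)

text \<open>The scalar action \<open>sc\<close> is a parameter because the extensions needed later
  have two kinds of target: the field itself and the free space on the symbols.\<close>

definition lin :: "('k::comm_ring_1 \<Rightarrow> 'v \<Rightarrow> 'v) \<Rightarrow> ('a \<Rightarrow> 'v) \<Rightarrow> ('a \<Rightarrow>\<^sub>0 'k) \<Rightarrow> 'v::ab_group_add" where
  "lin sc g x = (\<Sum>a\<in>Poly_Mapping.keys x. sc (Poly_Mapping.lookup x a) (g a))"

context module
begin

text \<open>Cancellation can make the support of a sum smaller than the union of the supports. Over
  a common finite index set, linearity in \<open>x\<close> becomes a termwise identity.\<close>

lemma lin_superset:
  assumes "finite S" "Poly_Mapping.keys x \<subseteq> S"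
  shows "lin scale g x = (\<Sum>a\<in>S. scale (Poly_Mapping.lookup x a) (g a))"
  unfolding lin_def using assms
  by (intro sum.mono_neutral_left) (auto simp: in_keys_iff)

end

lemma lin_add:
  assumes "module sc"
  shows "lin sc g (x + y) = lin sc g x + lin sc g y"
proof -
  interpret module sc by fact
  let ?S = "Poly_Mapping.keys x \<union> Poly_Mapping.keys y"
  have "Poly_Mapping.keys (x + y) \<subseteq> ?S" by (rule Poly_Mapping.keys_add)
  then show ?thesis
    by (simp add: lin_superset[of ?S] lookup_add scale_left_distrib sum.distrib)
qed

lemma lin_scale:
  assumes "module sc"
  shows "lin sc g (poly_scale c x) = sc c (lin sc g x)"
proof -
  interpret module sc by fact
  show ?thesis using keys_poly_scale_subset[of c x]
    by (simp add: lin_superset[of "Poly_Mapping.keys x"] scale_sum_right)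
qed

lemma lin_diff:
  assumes "module sc"
  shows "lin sc g (x - y) = lin sc g x - lin sc g y"
  using lin_add[OF assms, of g "x - y" y] by simp

lemma lin_zero [simp]: "lin sc g 0 = 0"
  by (simp add: lin_def)

lemma lin_single [simp]:
  assumes "module sc"
  shows "lin sc g (Poly_Mapping.single a c) = sc c (g a)"
proof -
  interpret module sc by fact
  show ?thesis by (simp add: lin_superset[of "{a}"])
qed

lemma lin_fun_add:
  assumes "module sc"
  shows "lin sc (\<lambda>a. g a + h a) x = lin sc g x + lin sc h x"
proof -
  interpret module sc by fact
  show ?thesis by (simp add: lin_def scale_right_distrib sum.distrib)
qed

lemma lin_fun_diff:
  assumes "module sc"
  shows "lin sc (\<lambda>a. g a - h a) x = lin sc g x - lin sc h x"
proof -
  interpret module sc by fact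
  show ?thesis by (simp add: lin_def scale_right_diff_distrib sum_subtractf)
qed

lemma lin_fun_scale:
  assumes "module sc"
  shows "lin sc (\<lambda>a. sc c (g a)) x = sc c (lin sc g x)"
proof -
  interpret module sc by fact
  show ?thesis by (simp add: lin_def scale_sum_right mult.commute)
qed

lemma lin_mem_subspace:
  assumes "module sc" "module.subspace sc N" "\<And>a. a \<in> Poly_Mapping.keys x \<Longrightarrow> g a \<in> N"
  shows "lin sc g x \<in> N"
proof -
  interpret module sc by fact
  show ?thesis unfolding lin_def using assms(2,3)
    by (intro subspace_sum subspace_scale) auto
qed

lemma lin_poly_single [simp]: "lin poly_scale (\<lambda>a. Poly_Mapping.single a 1) x = x"
  by (rule poly_mapping_eqI)
    (simp add: lin_def poly_scale_single lookup_sum lookup_single when_def in_keys_iff)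

section \<open>Integral orthogonalisation and the shape of additive functionals\<close>

context integral_lattice
begin

lemma form_add_right: "form x (y + z) = form x y + form x z"
  by (metis form_add_left form_sym)

lemma form_zero_left [simp]: "form 0 x = 0"
  using form_add_left[of 0 0 x] by simp

text \<open>Additivity alone forces compatibility with integer multiples; this serves both for
  functionals on the lattice and for the form in its left argument.\<close>

lemma additive_smul:
  assumes "additive (f :: 'l \<Rightarrow> 'r::ring_1)"
  shows "f (smul c x) = of_int c * f x"
proof (induction c rule: int_induct[where k = 0])
  interpret additive f by fact
  case base then show ?case by (simp add: zero)
next
  interpret additive f by fact
  case (step1 i) then show ?case by (simp add: scale_left_distrib add algebra_simps)
next
  interpret additive f by fact
  case (step2 i) then show ?case by (simp add: scale_left_diff_distrib diff algebra_simps)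
qed

lemma additive_form_left: "additive (\<lambda>x. form x z)"
  by unfold_locales (rule form_add_left)

lemma form_smul_left: "form (smul c x) y = c * form x y"
  using additive_smul[OF additive_form_left] by simp

lemma form_sum_left: "form (\<Sum>e\<in>E. g e) x = (\<Sum>e\<in>E. form (g e) x)"
  using additive.sum[OF additive_form_left] by blast

lemma exists_orthogonal_family:
  assumes "finite S"
  shows "\<exists>E. finite E \<and> 0 \<notin> E \<and> (\<forall>e\<in>E. \<forall>f\<in>E. e \<noteq> f \<longrightarrow> form e f = 0) \<and>
    (\<forall>x\<in>S. \<exists>N>0. smul N x \<in> span E)"
  using assms
proof (induction S rule: finite_induct)
  case empty
  show ?case by (rule exI[of _ "{}"]) simp
next
  case (insert x S)
  then obtain E where E: "finite E" "0 \<notin> E"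
    and orth: "\<And>e f. e \<in> E \<Longrightarrow> f \<in> E \<Longrightarrow> e \<noteq> f \<Longrightarrow> form e f = 0"
    and S: "\<And>x. x \<in> S \<Longrightarrow> \<exists>N>0. smul N x \<in> span E" by meson
  \<comment> \<open>\<open>M\<close> clears the denominators \<open>form e e\<close> of the
    Gram-Schmidt projection of \<open>x\<close>. Each norm is a factor of the product, so
    \<open>M div form e e\<close> is an exact quotient.\<close>
  define M where "M = (\<Prod>e\<in>E. form e e)"
  have pos: "form e e > 0" if "e \<in> E" for e using that E form_pos_def by metis
  then have "M > 0" unfolding M_def by (intro prod_pos) auto
  define p where "p = (\<Sum>e\<in>E. smul (M div form e e * form x e) e)"
  define y where "y = smul M x - p"
  have p: "p \<in> span E" unfolding p_def by (intro span_sum span_scale span_base)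
  have y: "form y f = 0" if "f \<in> E" for f
  proof -
    have "form p f = (\<Sum>e\<in>E. if e = f then M div form e e * form x e * form e f else 0)"
      unfolding p_def form_sum_left form_smul_left using that orth by (intro sum.cong) auto
    also have "\<dots> = M div form f f * form f f * form x f" using that E by simp
    also have "\<dots> = M * form x f" unfolding M_def using that E(1)
      using dvd_prodI[of E f "\<lambda>e. form e e"] by simp
    finally show ?thesis
      using additive.diff[OF additive_form_left, of "smul M x" p f]
      by (simp add: y_def form_smul_left)
  qed
  show ?case
  \<comment> \<open>A zero remainder must stay out of the family, because later coefficients divide
    by the norms of its members; in that case \<open>smul M x\<close> is already in the old
    span.\<close>
  proof (cases "y = 0")
    case True
    then have "smul M x \<in> span E" using p by (simp add: y_def)
    then show ?thesis using E orth S \<open>M > 0\<close>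
      by (intro exI[of _ E] conjI ballI) blast+
  next
    case False
    have "smul M x = y + p" by (simp add: y_def)
    also have "\<dots> \<in> span (insert y E)"
      using p span_mono[of E "insert y E"] by (intro span_add) (auto intro: span_base)
    finally have x: "smul M x \<in> span (insert y E)" .
    have sub: "span E \<subseteq> span (insert y E)" by (rule span_mono) auto
    have span: "\<exists>N>0. smul N z \<in> span (insert y E)" if z: "z \<in> insert x S" for z
    proof (cases "z = x")
      case False
      then show ?thesis using S[of z] z sub by fast
    qed (use x \<open>M > 0\<close> in fast)
    have yE: "form y f = 0" "form f y = 0" if "f \<in> E" for f
      using y[OF that] form_sym[of f y] by simp_all
    have "form e f = 0" if "e \<in> insert y E" "f \<in> insert y E" "e \<noteq> f" for e f
      using that orth[of e f] yE by (elim insertE) simp_all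
    moreover have "finite (insert y E)" "0 \<notin> insert y E" using E False by auto
    ultimately show ?thesis using span
      by (intro exI[of _ "insert y E"] conjI ballI impI) assumption+
  qed
qed

text \<open>By orthogonality, \<open>s\<close> and the sum agree on \<open>E\<close>, hence on its
  span. A positive multiple of every basis vector lies there, and characteristic zero allows that
  multiple to be cancelled in the field.\<close>

lemma additive_eq_sum_form:
  fixes s :: "'l \<Rightarrow> 'k::field_char_0"
  assumes "additive s"
  obtains E where "finite E"
    "s = (\<lambda>x. \<Sum>e\<in>E. s e / of_int (form e e) * of_int (form e x))"
proof -
  from finite_free obtain B where B: "finite B" "span B = UNIV" by blast
  obtain E where E: "finite E" "0 \<notin> E"
    and orth: "\<forall>e\<in>E. \<forall>f\<in>E. e \<noteq> f \<longrightarrow> form e f = 0"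
    and N: "\<forall>x\<in>B. \<exists>N>0. smul N x \<in> span E"
    using exists_orthogonal_family[OF B(1)] by (elim exE conjE)
  define r where "r x = s x - (\<Sum>e\<in>E. s e / of_int (form e e) * of_int (form e x))" for x
  have r: "additive r"
    using additive.add[OF assms]
    by unfold_locales (simp add: r_def form_add_right algebra_simps sum.distrib)
  have sub: "subspace {x. r x = 0}"
    using additive.zero[OF r] additive.add[OF r] additive_smul[OF r] by (intro subspaceI) auto
  have "E \<subseteq> {x. r x = 0}"
  proof
    fix f assume f: "f \<in> E"
    have "(\<Sum>e\<in>E. s e / of_int (form e e) * of_int (form e f))
        = (\<Sum>e\<in>E. if e = f then s f / of_int (form f f) * of_int (form f f) else 0)"
      using f orth by (intro sum.cong) auto
    moreover have "form f f > 0" using f E form_pos_def by metis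
    ultimately show "f \<in> {x. r x = 0}" using f E by (simp add: r_def)
  qed
  then have span_E: "span E \<subseteq> {x. r x = 0}" using sub by (rule span_minimal)
  have "B \<subseteq> {x. r x = 0}"
  proof
    fix x assume "x \<in> B"
    then obtain N :: int where "N > 0" "smul N x \<in> span E" using N by blast
    then have "of_int N * r x = 0" using span_E additive_smul[OF r, of N x] by auto
    then show "x \<in> {x. r x = 0}" using \<open>N > 0\<close> by simp
  qed
  then have "span B \<subseteq> {x. r x = 0}" using sub by (rule span_minimal)
  then have "r x = 0" for x using B by auto
  then have "s x = (\<Sum>e\<in>E. s e / of_int (form e e) * of_int (form e x))" for x
    unfolding r_def by (rule iffD1[OF right_minus_eq])
  then have "s = (\<lambda>x. \<Sum>e\<in>E. s e / of_int (form e e) * of_int (form e x))"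
    by (rule ext)
  then show ?thesis using E(1) by (intro that)
qed

end

lemma linear_endo_closed:
  "linear_endo V f \<Longrightarrow> x \<in> carrier V \<Longrightarrow> f x \<in> carrier V"
  by (auto simp: linear_endo_def)

section \<open>The pulled-back extension and the action of w on it\<close>

context extension_setting
begin

sublocale cyclic: group "cyclic_mult_group \<zeta>"
  using H_extension by (simp add: central_extension_def)

sublocale H: group H
  using H_extension by (simp add: central_extension_def)

lemma \<iota>_hom: "\<iota> \<in> hom (cyclic_mult_group \<zeta>) H"
  using H_extension by (simp add: central_extension_def)

lemma \<pi>_hom: "\<pi> \<in> hom H (coinvariants w)"
  using H_extension by (simp add: central_extension_def)

lemma w_add: "w (x + y) = w x + w y"
  using w_aut module_hom.add[of smul smul w x y] by (simp add: lattice_aut_def)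

lemma form_w: "form (w x) (w y) = form x y"
  using w_aut by (simp add: lattice_aut_def)

lemma bij_w: "bij w"
  using w_aut by (simp add: lattice_aut_def)

lemma w_zero [simp]: "w 0 = 0"
  using w_add[of 0 0] by simp

lemma w_minus: "w (- x) = - w x"
  using w_add[of "- x" x] by (simp add: eq_neg_iff_add_eq_0)

lemma w_root_iff [simp]: "w x \<in> roots \<longleftrightarrow> x \<in> roots"
  by (simp add: roots_def form_w)

lemma mem_coinv_class: "y \<in> coinv_class w x \<longleftrightarrow> (\<exists>z. y = z - w z + x)"
  by (auto simp: coinv_class_def r_coset_def additive_group_def)

text \<open>Together with multiplicativity of \<pi> this shows that the fibre product
  \<open>lattice_ext\<close> is closed under multiplication.\<close>

lemma coinv_class_add:
  "coinv_class w x \<otimes>\<^bsub>coinvariants w\<^esub> coinv_class w y = coinv_class w (x + y)"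
proof -
  have "u + v \<in> coinv_class w (x + y)" if "u \<in> coinv_class w x" "v \<in> coinv_class w y" for u v
  proof -
    from that obtain a b where "u = a - w a + x" "v = b - w b + y"
      by (auto simp: mem_coinv_class)
    then have "u + v = (a + b) - w (a + b) + (x + y)" by (simp add: w_add)
    then show ?thesis unfolding mem_coinv_class by (rule exI)
  qed
  moreover have "\<exists>u\<in>coinv_class w x. \<exists>v\<in>coinv_class w y. t = u + v"
    if "t \<in> coinv_class w (x + y)" for t
  proof -
    from that obtain a where "t = a - w a + (x + y)" by (auto simp: mem_coinv_class)
    then have "t = (a - w a + x) + y" by simp
    moreover have "a - w a + x \<in> coinv_class w x" "y \<in> coinv_class w y"
      unfolding mem_coinv_class by (auto intro: exI[of _ 0])
    ultimately show ?thesis by blast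
  qed
  ultimately have "(\<Union>u\<in>coinv_class w x. \<Union>v\<in>coinv_class w y. {u + v}) = coinv_class w (x + y)"
    by blast
  then show ?thesis
    by (simp add: coinvariants_def FactGroup_def set_mult_def additive_group_def)
qed

lemma coinv_class_zero: "coinv_class w 0 = \<one>\<^bsub>coinvariants w\<^esub>"
  by (auto simp: mem_coinv_class coinvariants_def FactGroup_def)

text \<open>The difference of \<open>x\<close> and \<open>w x\<close> is a value of 1 - w. Hence
  \<open>w_ext\<close> may leave the component in \<open>H\<close> untouched and still land in the
  fibre product.\<close>

lemma coinv_class_w [simp]: "coinv_class w (w x) = coinv_class w x"
proof -
  have "\<exists>u. z - w z + w x = u - w u + x" for z
    by (rule exI[of _ "z - x"]) (simp add: w_add[of z "- x", simplified] w_minus)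
  moreover have "\<exists>u. z - w z + x = u - w u + w x" for z
    by (rule exI[of _ "z + x"]) (simp add: w_add)
  ultimately show ?thesis by (auto simp: mem_coinv_class)
qed

lemma \<mu>_closed [simp]: "\<zeta> \<in> \<mu>"
  by (auto simp: cyclic_mult_group_def intro: range_eqI[of _ _ 1])

lemma \<iota>_closed: "z \<in> \<mu> \<Longrightarrow> \<iota> z \<in> carrier H"
  using \<iota>_hom by (auto simp: hom_def)

lemma \<iota>_mult: "y \<in> \<mu> \<Longrightarrow> z \<in> \<mu> \<Longrightarrow> \<iota> (y * z) = \<iota> y \<otimes>\<^bsub>H\<^esub> \<iota> z"
  using \<iota>_hom by (auto simp: hom_def cyclic_mult_group_def)

lemma \<mu>_mult: "y \<in> \<mu> \<Longrightarrow> z \<in> \<mu> \<Longrightarrow> y * z \<in> \<mu>"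
  using cyclic.m_closed by (simp add: cyclic_mult_group_def)

lemma \<iota>_image: "\<iota> ` \<mu> = kernel H (coinvariants w) \<pi>"
  using H_extension by (simp add: central_extension_def)

lemma \<pi>_\<iota>: "z \<in> \<mu> \<Longrightarrow> \<pi> (\<iota> z) = coinv_class w 0"
  using \<iota>_image by (auto simp: kernel_def coinv_class_zero)

lemma \<iota>_central: "z \<in> \<mu> \<Longrightarrow> h \<in> carrier H \<Longrightarrow> \<iota> z \<otimes>\<^bsub>H\<^esub> h = h \<otimes>\<^bsub>H\<^esub> \<iota> z"
  using H_extension by (simp add: central_extension_def)

lemma lattice_ext_carrier:
  "a \<in> carrier lattice_ext \<longleftrightarrow> snd a \<in> carrier H \<and> \<pi> (snd a) = coinv_class w (fst a)"
  by (cases a) (simp add: lattice_ext_def)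

lemma lattice_ext_mult:
  "a \<otimes>\<^bsub>lattice_ext\<^esub> b = (fst a + fst b, snd a \<otimes>\<^bsub>H\<^esub> snd b)"
  by (cases a; cases b) (simp add: lattice_ext_def)

lemma fst_lattice_ext_mult [simp]: "fst (a \<otimes>\<^bsub>lattice_ext\<^esub> b) = fst a + fst b"
  by (simp add: lattice_ext_mult)

lemma lattice_ext_closed:
  "a \<in> carrier lattice_ext \<Longrightarrow> b \<in> carrier lattice_ext \<Longrightarrow>
    a \<otimes>\<^bsub>lattice_ext\<^esub> b \<in> carrier lattice_ext"
  using \<pi>_hom by (auto simp: lattice_ext_carrier lattice_ext_mult coinv_class_add hom_def)

lemma lattice_ext_assoc:
  "a \<in> carrier lattice_ext \<Longrightarrow> b \<in> carrier lattice_ext \<Longrightarrow> c \<in> carrier lattice_ext \<Longrightarrow>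
    a \<otimes>\<^bsub>lattice_ext\<^esub> b \<otimes>\<^bsub>lattice_ext\<^esub> c =
    a \<otimes>\<^bsub>lattice_ext\<^esub> (b \<otimes>\<^bsub>lattice_ext\<^esub> c)"
  by (simp add: lattice_ext_carrier lattice_ext_mult H.m_assoc add.assoc)

lemma fst_ext_incl [simp]: "fst (ext_incl z) = 0"
  by (simp add: ext_incl_def)

lemma ext_incl_closed: "z \<in> \<mu> \<Longrightarrow> ext_incl z \<in> carrier lattice_ext"
  by (simp add: lattice_ext_carrier ext_incl_def \<pi>_\<iota> \<iota>_closed)

lemma ext_incl_mult:
  "y \<in> \<mu> \<Longrightarrow> z \<in> \<mu> \<Longrightarrow> ext_incl (y * z) = ext_incl y \<otimes>\<^bsub>lattice_ext\<^esub> ext_incl z"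
  by (simp add: ext_incl_def lattice_ext_mult \<iota>_mult)

lemma ext_incl_central:
  "z \<in> \<mu> \<Longrightarrow> a \<in> carrier lattice_ext \<Longrightarrow>
    ext_incl z \<otimes>\<^bsub>lattice_ext\<^esub> a = a \<otimes>\<^bsub>lattice_ext\<^esub> ext_incl z"
  by (simp add: ext_incl_def lattice_ext_mult lattice_ext_carrier \<iota>_central)

lemma ext_incl_inj: "inj_on ext_incl \<mu>"
  using H_extension by (auto simp: ext_incl_def inj_on_def central_extension_def)

text \<open>Exactness at \<open>H\<close>: over 0 the second component lies in the kernel of \<pi>.
  With injectivity of \<open>ext_incl\<close> this makes the product of lifts of opposite roots a
  genuine scalar, read off by \<open>the_inv_into\<close>.\<close>

lemma ext_incl_surj:
  assumes "a \<in> carrier lattice_ext" "fst a = 0"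
  obtains z where "z \<in> \<mu>" "a = ext_incl z"
proof -
  have "snd a \<in> kernel H (coinvariants w) \<pi>"
    using assms by (simp add: lattice_ext_carrier kernel_def coinv_class_zero)
  then obtain z where "z \<in> \<mu>" "snd a = \<iota> z" using \<iota>_image by blast
  then show ?thesis using that assms by (cases a) (simp add: ext_incl_def)
qed

lemma the_inv_ext_incl_scale:
  assumes "a \<in> carrier lattice_ext" "fst a = 0"
  shows "the_inv_into \<mu> ext_incl (ext_incl \<zeta> \<otimes>\<^bsub>lattice_ext\<^esub> a) =
    \<zeta> * the_inv_into \<mu> ext_incl a"
proof -
  obtain z where z: "z \<in> \<mu>" "a = ext_incl z" using ext_incl_surj[OF assms] .
  then have "ext_incl \<zeta> \<otimes>\<^bsub>lattice_ext\<^esub> a = ext_incl (\<zeta> * z)"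
    by (simp add: ext_incl_mult)
  then show ?thesis
    using z \<mu>_mult[OF \<mu>_closed z(1)] by (simp add: the_inv_into_f_f[OF ext_incl_inj])
qed

lemma ext_roots_carrier: "a \<in> ext_roots \<Longrightarrow> a \<in> carrier lattice_ext"
  by (simp add: ext_roots_def)

lemma ext_roots_mult:
  "a \<in> ext_roots \<Longrightarrow> b \<in> ext_roots \<Longrightarrow> fst a + fst b \<in> roots \<Longrightarrow>
    a \<otimes>\<^bsub>lattice_ext\<^esub> b \<in> ext_roots"
  by (simp add: ext_roots_def lattice_ext_closed)

lemma ext_scale_left:
  "a \<in> ext_roots \<Longrightarrow> b \<in> ext_roots \<Longrightarrow>
    (ext_incl \<zeta> \<otimes>\<^bsub>lattice_ext\<^esub> a) \<otimes>\<^bsub>lattice_ext\<^esub> b =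
    ext_incl \<zeta> \<otimes>\<^bsub>lattice_ext\<^esub> (a \<otimes>\<^bsub>lattice_ext\<^esub> b)"
  by (simp add: lattice_ext_assoc ext_incl_closed ext_roots_carrier)

text \<open>The factor \<zeta> has to be moved past \<open>a\<close>, and this is the point where
  centrality enters; associativity settles the left-hand version.\<close>

lemma ext_scale_right:
  assumes "a \<in> ext_roots" "b \<in> ext_roots"
  shows "a \<otimes>\<^bsub>lattice_ext\<^esub> (ext_incl \<zeta> \<otimes>\<^bsub>lattice_ext\<^esub> b) =
    ext_incl \<zeta> \<otimes>\<^bsub>lattice_ext\<^esub> (a \<otimes>\<^bsub>lattice_ext\<^esub> b)"
  using assms lattice_ext_assoc[of a "ext_incl \<zeta>" b] lattice_ext_assoc[of "ext_incl \<zeta>" a b]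
  by (simp add: ext_incl_closed ext_roots_carrier ext_incl_central)

lemma fst_w_ext [simp]: "fst (w_ext a) = w (fst a)"
  by (cases a) (simp add: w_ext_def)

lemma snd_w_ext [simp]: "snd (w_ext a) = snd a"
  by (cases a) (simp add: w_ext_def)

lemma w_ext_mult: "w_ext (a \<otimes>\<^bsub>lattice_ext\<^esub> b) = w_ext a \<otimes>\<^bsub>lattice_ext\<^esub> w_ext b"
  by (simp add: prod_eq_iff lattice_ext_mult w_add)

lemma w_ext_incl [simp]: "w_ext (ext_incl z) = ext_incl z"
  by (simp add: prod_eq_iff)

lemma w_ext_root_iff [simp]: "w_ext a \<in> ext_roots \<longleftrightarrow> a \<in> ext_roots"
  by (simp add: ext_roots_def lattice_ext_carrier)

lemma w_ext_funpow: "(w_ext ^^ n) a = ((w ^^ n) (fst a), snd a)"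
  by (induction n) (auto simp: prod_eq_iff)

end

section \<open>The quotient by the symbol relations, and generation of the Lie algebra\<close>

context input_datum
begin

lemma sym_relations_subspace: "poly.subspace sym_relations"
  unfolding sym_relations_def by (rule poly.subspace_span)

lemma sym_class_eq_iff: "sym_class x = sym_class y \<longleftrightarrow> x - y \<in> sym_relations"
proof
  assume "sym_class x = sym_class y"
  moreover have "x \<in> sym_class x"
    unfolding sym_class_def using poly.subspace_0[OF sym_relations_subspace] by force
  ultimately obtain n where "n \<in> sym_relations" "x = y + n" by (auto simp: sym_class_def)
  then show "x - y \<in> sym_relations" by simp
next
  assume n: "x - y \<in> sym_relations"
  have "x + m \<in> sym_class y" if "m \<in> sym_relations" for m
    unfolding sym_class_def using poly.subspace_add[OF sym_relations_subspace n that]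
    by (auto intro!: exI[of _ "x - y + m"])
  moreover have "y + m \<in> sym_class x" if "m \<in> sym_relations" for m
    unfolding sym_class_def using poly.subspace_diff[OF sym_relations_subspace that n]
    by (auto intro!: exI[of _ "m - (x - y)"])
  ultimately show "sym_class x = sym_class y" by (auto simp: sym_class_def)
qed

lemma sym_add_class: "sym_add (sym_class x) (sym_class y) = sym_class (x + y)"
proof -
  have "\<exists>m. x + n + (y + n') = x + y + m \<and> m \<in> sym_relations"
    if "n \<in> sym_relations" "n' \<in> sym_relations" for n n'
    using poly.subspace_add[OF sym_relations_subspace that]
    by (intro exI[of _ "n + n'"]) (simp add: algebra_simps)
  moreover have "\<exists>u v. x + y + n = u + v \<and> (\<exists>n. u = x + n \<and> n \<in> sym_relations) \<and>
      (\<exists>n. v = y + n \<and> n \<in> sym_relations)" if "n \<in> sym_relations" for n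
    using that poly.subspace_0[OF sym_relations_subspace]
    by (intro exI[of _ "x + n"] exI[of _ y]) (auto simp: algebra_simps)
  ultimately show ?thesis by (auto simp: sym_add_def sym_class_def)
qed

lemma sym_scale_class: "sym_scale c (sym_class x) = sym_class (poly_scale c x)"
proof -
  have "\<exists>m. poly_scale c (x + n) + n' = poly_scale c x + m \<and> m \<in> sym_relations"
    if "n \<in> sym_relations" "n' \<in> sym_relations" for n n'
    using poly.subspace_add[OF sym_relations_subspace
        poly.subspace_scale[OF sym_relations_subspace that(1)] that(2), of c]
    by (intro exI[of _ "poly_scale c n + n'"]) (simp add: poly.scale_right_distrib algebra_simps)
  moreover have "\<exists>u m. poly_scale c x + n = poly_scale c u + m \<and>
      (\<exists>n. u = x + n \<and> n \<in> sym_relations) \<and> m \<in> sym_relations"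
    if "n \<in> sym_relations" for n
    using that poly.subspace_0[OF sym_relations_subspace]
    by (intro exI[of _ x] exI[of _ n]) auto
  ultimately show ?thesis by (auto simp: sym_scale_def sym_class_def)
qed

text \<open>The preimage of \<open>N\<close> under a linear map is a subspace, so the spanning
  relations suffice. Taking \<open>N\<close> to be \<open>sym_relations\<close> treats maps into the
  symbol space, and taking it to be zero treats scalar-valued maps.\<close>

lemma lin_mem_of_sym_relations:
  assumes "module sc" "module.subspace sc N" "n \<in> sym_relations"
    "\<And>a. a \<in> ext_roots \<Longrightarrow> g (ext_incl \<zeta> \<otimes>\<^bsub>lattice_ext\<^esub> a) - sc \<zeta> (g a) \<in> N"
  shows "lin sc g n \<in> N"
proof -
  interpret sc: module sc by fact
  let ?M = "{x. lin sc g x \<in> N}"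
  have "poly.subspace ?M"
    using assms(2) by (intro poly.subspaceI)
      (auto simp: lin_add[OF assms(1)] lin_scale[OF assms(1)] sc.subspace_0 sc.subspace_add sc.subspace_scale)
  moreover have "{Poly_Mapping.single (ext_incl \<zeta> \<otimes>\<^bsub>lattice_ext\<^esub> a) 1
      - poly_scale \<zeta> (Poly_Mapping.single a 1) | a. a \<in> ext_roots} \<subseteq> ?M"
    using assms(4) by (auto simp: lin_diff[OF assms(1)] lin_scale[OF assms(1)] lin_single[OF assms(1)])
  ultimately have "sym_relations \<subseteq> ?M"
    unfolding sym_relations_def by (intro poly.span_minimal)
  then show ?thesis using assms(3) by blast
qed

lemma check_mem [simp]: "check \<gamma> \<in> dual_space"
  by (auto simp: dual_space_def check_def form_add_right intro!: additive.intro)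

lemma dual_space_closed:
  "(\<lambda>_. 0) \<in> dual_space"
  "s \<in> dual_space \<Longrightarrow> t \<in> dual_space \<Longrightarrow> (\<lambda>x. s x + t x) \<in> dual_space"
  "s \<in> dual_space \<Longrightarrow> (\<lambda>x. c * s x) \<in> dual_space"
  by (auto simp: dual_space_def additive_def algebra_simps)

text \<open>The induction form of the fact that the checks of roots span: integer combinations reach
  the check of every lattice vector, and the orthogonal expansion then reaches every additive
  functional.\<close>

lemma dual_space_induct [consumes 1, case_names zero add scale check]:
  assumes s: "s \<in> dual_space"
    and zero: "P (\<lambda>_. 0)"
    and add: "\<And>s t. s \<in> dual_space \<Longrightarrow> t \<in> dual_space \<Longrightarrow> P s \<Longrightarrow> P t \<Longrightarrow> P (\<lambda>x. s x + t x)"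
    and scale: "\<And>c s. s \<in> dual_space \<Longrightarrow> P s \<Longrightarrow> P (\<lambda>x. c * s x)"
    and check: "\<And>\<alpha>. \<alpha> \<in> roots \<Longrightarrow> P (check \<alpha>)"
  shows "P s"
proof -
  have "P (check \<gamma>)" for \<gamma>
  proof -
    have "\<gamma> \<in> span roots" using roots_generate by simp
    then show ?thesis
    proof (induction rule: span_induct_alt)
      case base
      then show ?case using zero by (simp add: check_def)
    next
      case (step c x y)
      have "check (smul c x + y) = (\<lambda>z. of_int c * check x z + check y z)"
        by (simp add: check_def form_add_left form_smul_left)
      moreover have "P (\<lambda>z. of_int c * check x z)"
        using step by (intro scale check) simp_all
      ultimately show ?case
        using add[OF dual_space_closed(3)[OF check_mem] check_mem _ step.IH] by simp
    qed
  qed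
  then have *: "P (\<lambda>x. c * of_int (form e x))" for c e
    using scale[OF check_mem, of e c] by (simp add: check_def)
  from s have "additive s" by (simp add: dual_space_def)
  then obtain E where "finite E"
    and sE: "s = (\<lambda>x. \<Sum>e\<in>E. s e / of_int (form e e) * of_int (form e x))"
    by (rule additive_eq_sum_form)
  \<comment> \<open>Membership is carried along because the rule \<open>add\<close> asks for it. The
    coefficients are generalised to \<open>c\<close>, so that they do not depend on the shrinking
    set \<open>E\<close>.\<close>
  have "(\<lambda>x. \<Sum>e\<in>E. c e * of_int (form e x)) \<in> dual_space
      \<and> P (\<lambda>x. \<Sum>e\<in>E. c e * of_int (form e x))" for c
    using \<open>finite E\<close>
  proof (induction E rule: finite_induct)
    case empty
    then show ?case using zero dual_space_closed(1) by simp
  next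
    case (insert e E)
    have "(\<lambda>x. c e * of_int (form e x)) \<in> dual_space"
      using dual_space_closed(3)[OF check_mem, of "c e" e] by (simp add: check_def)
    from dual_space_closed(2)[OF this conjunct1[OF insert.IH]]
      add[OF this conjunct1[OF insert.IH] * conjunct2[OF insert.IH]]
    show ?case using insert.hyps by simp
  qed
  from conjunct2[OF this] show ?thesis by (rule back_subst[OF _ sE[symmetric]])
qed

end

lemma poly_mapping_eq_sum_single:
  "x = (\<Sum>a\<in>Poly_Mapping.keys x. Poly_Mapping.single a (Poly_Mapping.lookup x a :: 'k::field))"
proof -
  have "(\<Sum>a\<in>Poly_Mapping.keys x. Poly_Mapping.single a (Poly_Mapping.lookup x a)) =
      lin poly_scale (\<lambda>a. Poly_Mapping.single a 1) x"
    by (simp only: lin_def poly_scale_single mult_1_right)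
  then show ?thesis by (simp only: lin_poly_single)
qed

lemma linear_endo_comp:
  "linear_endo V f \<Longrightarrow> linear_endo V g \<Longrightarrow> linear_endo V (\<lambda>x. f (g x))"
  by (simp add: linear_endo_def Pi_iff)

lemma keys_add_subset:
  "Poly_Mapping.keys x \<subseteq> A \<Longrightarrow> Poly_Mapping.keys y \<subseteq> A \<Longrightarrow> Poly_Mapping.keys (x + y) \<subseteq> A"
  using Poly_Mapping.keys_add[of x y] by blast

lemma keys_scale_subset:
  "Poly_Mapping.keys x \<subseteq> A \<Longrightarrow> Poly_Mapping.keys (poly_scale c x) \<subseteq> A"
  using keys_poly_scale_subset[of c x] by blast

lemma subspace_keys_subset: "poly.subspace {x. Poly_Mapping.keys x \<subseteq> A}"
  by (intro poly.subspaceI) (simp_all add: keys_add_subset keys_scale_subset)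

context input_datum
begin

lemma lie_space_simps [simp]:
  "carrier lie_space = dual_space \<times> sym_space"
  "vadd lie_space (s, A) (t, B) = (\<lambda>x. s x + t x, sym_add A B)"
  "vscale lie_space c (s, A) = (\<lambda>x. c * s x, sym_scale c A)"
  by (simp_all add: lie_space_def)

lemma sym_class_mem: "Poly_Mapping.keys x \<subseteq> ext_roots \<Longrightarrow> sym_class x \<in> sym_space"
  by (auto simp: sym_space_def)

lemma carrier_cases:
  assumes "v \<in> carrier lie_space"
  obtains s x where "v = (s, sym_class x)" "s \<in> dual_space" "Poly_Mapping.keys x \<subseteq> ext_roots"
  using assms by (auto simp: sym_space_def)

lemma in_t_mem: "s \<in> dual_space \<Longrightarrow> in_t s \<in> carrier lie_space"
  by (simp add: in_t_def sym_class_mem)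

lemma in_l_class_mem: "Poly_Mapping.keys x \<subseteq> ext_roots \<Longrightarrow> in_l (sym_class x) \<in> carrier lie_space"
  by (simp add: in_l_def sym_class_mem dual_space_closed)

definition gens :: "('l, 'g, 'k) hvec set" where
  "gens = (in_t \<circ> check) ` roots \<union> (in_l \<circ> X) ` ext_roots"

lemma gens_mem: "v \<in> gens \<Longrightarrow> v \<in> carrier lie_space"
  using in_t_mem[OF check_mem] in_l_class_mem by (auto simp: gens_def X_def simp del: lie_space_simps)

lemma in_t_check_gens: "\<alpha> \<in> roots \<Longrightarrow> in_t (check \<alpha>) \<in> gens"
  by (simp add: gens_def)

lemma in_l_X_gens: "a \<in> ext_roots \<Longrightarrow> in_l (X a) \<in> gens"
  by (simp add: gens_def)

lemma vscale_zero:
  assumes "v \<in> carrier lie_space"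
  shows "vscale lie_space 0 v = in_t (\<lambda>_. 0)"
  using assms by (elim carrier_cases) (simp add: sym_scale_class in_t_def)

lemma lie_space_induct [consumes 1, case_names zero add scale gen]:
  assumes v: "v \<in> carrier lie_space"
    and zero: "P (in_t (\<lambda>_. 0))"
    and add: "\<And>u v. u \<in> carrier lie_space \<Longrightarrow> v \<in> carrier lie_space \<Longrightarrow> P u \<Longrightarrow> P v \<Longrightarrow>
      P (vadd lie_space u v)"
    and scale: "\<And>c u. u \<in> carrier lie_space \<Longrightarrow> P u \<Longrightarrow> P (vscale lie_space c u)"
    and gen: "\<And>u. u \<in> gens \<Longrightarrow> P u"
  shows "P v"
proof -
  obtain s x where v: "v = (s, sym_class x)" and s: "s \<in> dual_space"
    and x: "Poly_Mapping.keys x \<subseteq> ext_roots"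
    using v by (rule carrier_cases)
  have "P (in_t s)"
    using s
  proof (induction rule: dual_space_induct)
    case zero
    then show ?case by (rule assms)
  next
    case (add s t)
    from assms(3)[OF in_t_mem in_t_mem, OF this] show ?case by (simp add: in_t_def sym_add_class)
  next
    case (scale c s)
    from assms(4)[OF in_t_mem, OF this, of c] show ?case by (simp add: in_t_def sym_scale_class)
  next
    case (check \<alpha>)
    then show ?case by (intro gen in_t_check_gens)
  qed
  moreover have "P (in_l (sym_class x))"
  proof -
    \<comment> \<open>The support bound travels with \<open>P\<close> because \<open>add\<close>
      needs both summands in the carrier.\<close>
    have "Poly_Mapping.keys (\<Sum>a\<in>F. Poly_Mapping.single a (c a)) \<subseteq> ext_roots \<and>
        P (in_l (sym_class (\<Sum>a\<in>F. Poly_Mapping.single a (c a))))"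
      if "finite F" "F \<subseteq> ext_roots" for F and c :: "'l \<times> 'g \<Rightarrow> 'k"
      using that
    proof (induction F rule: finite_induct)
      case empty
      then show ?case using zero by (simp add: in_t_def in_l_def)
    next
      case (insert a F)
      have a: "Poly_Mapping.keys (Poly_Mapping.single a (c a)) \<subseteq> ext_roots"
        using insert.prems by simp
      have "P (vscale lie_space (c a) (in_l (X a)))"
        using insert.prems by (intro scale gen in_l_X_gens gens_mem) auto
      then have "P (in_l (sym_class (Poly_Mapping.single a (c a))))"
        by (simp add: in_l_def X_def sym_scale_class poly_scale_single)
      with add[OF in_l_class_mem[OF a] in_l_class_mem] insert a
      have "P (vadd lie_space (in_l (sym_class (Poly_Mapping.single a (c a))))
          (in_l (sym_class (\<Sum>a\<in>F. Poly_Mapping.single a (c a)))))"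
        by simp
      moreover have "Poly_Mapping.keys (Poly_Mapping.single a (c a) +
          (\<Sum>a\<in>F. Poly_Mapping.single a (c a))) \<subseteq> ext_roots"
        using insert a by (intro keys_add_subset) auto
      ultimately show ?case using insert.hyps by (simp add: in_l_def sym_add_class)
    qed
    from conjunct2[OF this[OF finite_keys x, of "Poly_Mapping.lookup x"]]
    show ?thesis
      by (rule back_subst[of "\<lambda>z. P (in_l (sym_class z))", OF _ poly_mapping_eq_sum_single[symmetric]])
  qed
  ultimately have "P (vadd lie_space (in_t s) (in_l (sym_class x)))"
    using s x by (intro add in_t_mem in_l_class_mem)
  then show ?thesis by (simp add: v in_t_def in_l_def sym_add_class)
qed

lemma linear_endo_zero:
  assumes "linear_endo lie_space f"
  shows "f (in_t (\<lambda>_. 0)) = in_t (\<lambda>_. 0)"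
proof -
  have z: "in_t (\<lambda>_. 0) \<in> carrier lie_space" by (intro in_t_mem dual_space_closed)
  then have "f (vscale lie_space 0 (in_t (\<lambda>_. 0))) = vscale lie_space 0 (f (in_t (\<lambda>_. 0)))"
    using assms by (simp add: linear_endo_def del: lie_space_simps)
  then show ?thesis
    by (simp only: vscale_zero[OF z] vscale_zero[OF linear_endo_closed[OF assms z]])
qed

lemma linear_endo_eqI:
  assumes "linear_endo lie_space f" "linear_endo lie_space g"
    and "\<And>u. u \<in> gens \<Longrightarrow> f u = g u" and "v \<in> carrier lie_space"
  shows "f v = g v"
  using assms(4)
proof (induction rule: lie_space_induct)
  case zero
  show ?case by (simp only: linear_endo_zero[OF assms(1)] linear_endo_zero[OF assms(2)])
next
  case (add u v)
  then show ?case using assms(1,2) by (simp add: linear_endo_def del: lie_space_simps)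
next
  case (scale c u)
  then show ?case using assms(1,2) by (simp add: linear_endo_def del: lie_space_simps)
qed (use assms(3) in blast)

text \<open>For a fixed generator \<open>u\<close>, linearity in the second argument extends the
  agreement to all \<open>v\<close>; linearity in the first argument then frees
  \<open>u\<close>.\<close>

lemma bilinear_op_eqI:
  assumes "bilinear_op lie_space B" "bilinear_op lie_space C"
    and gens: "\<And>u v. u \<in> gens \<Longrightarrow> v \<in> gens \<Longrightarrow> B u v = C u v"
    and u: "u \<in> carrier lie_space" and v: "v \<in> carrier lie_space"
  shows "B u v = C u v"
proof -
  have left: "linear_endo lie_space (B u)" "linear_endo lie_space (C u)"
    if "u \<in> carrier lie_space" for u
    using assms(1,2) that by (simp_all add: bilinear_op_def del: lie_space_simps)
  have right: "linear_endo lie_space (\<lambda>u. B u v)" "linear_endo lie_space (\<lambda>u. C u v)"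
    using assms(1,2) v by (simp_all add: bilinear_op_def del: lie_space_simps)
  have "B u v = C u v" if "u \<in> gens" for u
    by (rule linear_endo_eqI[OF left[OF gens_mem[OF that]] gens[OF that] v])
  from linear_endo_eqI[OF right this u] show ?thesis .
qed

section \<open>An explicit model of the bracket on representatives\<close>

lemma bilinear_ext_respects_relations:
  assumes sc: "module sc" and N: "module.subspace sc N"
    and left: "\<And>a b. a \<in> ext_roots \<Longrightarrow> b \<in> ext_roots \<Longrightarrow>
      \<beta> (ext_incl \<zeta> \<otimes>\<^bsub>lattice_ext\<^esub> a) b - sc \<zeta> (\<beta> a b) \<in> N"
    and right: "\<And>a b. a \<in> ext_roots \<Longrightarrow> b \<in> ext_roots \<Longrightarrow>
      \<beta> a (ext_incl \<zeta> \<otimes>\<^bsub>lattice_ext\<^esub> b) - sc \<zeta> (\<beta> a b) \<in> N"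
    and keys: "Poly_Mapping.keys x' \<subseteq> ext_roots" "Poly_Mapping.keys y \<subseteq> ext_roots"
    and rel: "x - x' \<in> sym_relations" "y - y' \<in> sym_relations"
  shows "lin sc (\<lambda>a. lin sc (\<beta> a) y) x - lin sc (\<lambda>a. lin sc (\<beta> a) y') x' \<in> N"
proof -
  interpret sc: module sc by fact
  \<comment> \<open>For a bilinear B the difference splits as B(x - x', y) + B(x', y - y'). Each
    relation thus meets \<open>y\<close> or \<open>x'\<close>, which is why exactly these two are
    required to be supported on \<open>ext_roots\<close>.\<close>
  have "lin sc (\<lambda>a. lin sc (\<beta> a) y) (x - x') \<in> N"
  proof (rule lin_mem_of_sym_relations[OF sc N rel(1)])
    fix a assume "a \<in> ext_roots"
    then have "lin sc (\<lambda>b. \<beta> (ext_incl \<zeta> \<otimes>\<^bsub>lattice_ext\<^esub> a) b - sc \<zeta> (\<beta> a b)) y \<in> N"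
      using keys by (intro lin_mem_subspace[OF sc N] left) auto
    then show "lin sc (\<beta> (ext_incl \<zeta> \<otimes>\<^bsub>lattice_ext\<^esub> a)) y - sc \<zeta> (lin sc (\<beta> a) y) \<in> N"
      by (simp add: lin_fun_diff[OF sc] lin_fun_scale[OF sc])
  qed
  moreover have "lin sc (\<lambda>a. lin sc (\<beta> a) (y - y')) x' \<in> N"
    using keys
    by (intro lin_mem_subspace[OF sc N] lin_mem_of_sym_relations[OF sc N rel(2)] right) auto
  ultimately have "lin sc (\<lambda>a. lin sc (\<beta> a) y) (x - x') +
      lin sc (\<lambda>a. lin sc (\<beta> a) (y - y')) x' \<in> N"
    by (rule sc.subspace_add[OF N])
  then show ?thesis
    by (simp add: lin_diff[OF sc] lin_fun_diff[OF sc])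
qed

text \<open>An element \<open>s\<close> of the torus scales \<open>X\<^bsub>b\<^esub>\<close> by \<open>s b\<close>, because
  \<open>check \<alpha>\<close> evaluates to \<open>form \<alpha> b\<close> there.\<close>
definition torus_act :: "('l \<Rightarrow> 'k) \<Rightarrow> ('l \<times> 'g \<Rightarrow>\<^sub>0 'k) \<Rightarrow> ('l \<times> 'g \<Rightarrow>\<^sub>0 'k)" where
  "torus_act s = lin poly_scale (\<lambda>b. Poly_Mapping.single b (s (fst b)))"

text \<open>The functional is taken at a point \<open>l\<close>, so that its bilinear extension has
  values in the field.\<close>

definition torus_part :: "'l \<times> 'g \<Rightarrow> 'l \<times> 'g \<Rightarrow> 'l \<Rightarrow> 'k" where
  "torus_part a b l =
    (if fst a + fst b = 0
     then \<epsilon> (fst a) (fst b) * the_inv_into \<mu> ext_incl (a \<otimes>\<^bsub>lattice_ext\<^esub> b) * check (fst a) l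
     else 0)"

definition sym_part :: "'l \<times> 'g \<Rightarrow> 'l \<times> 'g \<Rightarrow> ('l \<times> 'g \<Rightarrow>\<^sub>0 'k)" where
  "sym_part a b =
    (if fst a + fst b \<in> roots
     then Poly_Mapping.single (a \<otimes>\<^bsub>lattice_ext\<^esub> b) (\<epsilon> (fst a) (fst b)) else 0)"

definition rep_torus ::
  "('l \<times> 'g \<Rightarrow>\<^sub>0 'k) \<Rightarrow> ('l \<times> 'g \<Rightarrow>\<^sub>0 'k) \<Rightarrow> 'l \<Rightarrow> 'k" where
  "rep_torus x y l = lin (*) (\<lambda>a. lin (*) (\<lambda>b. torus_part a b l) y) x"

definition rep_sym ::
  "('l \<times> 'g \<Rightarrow>\<^sub>0 'k) \<Rightarrow> ('l \<times> 'g \<Rightarrow>\<^sub>0 'k) \<Rightarrow> ('l \<times> 'g \<Rightarrow>\<^sub>0 'k)" where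
  "rep_sym x y = lin poly_scale (\<lambda>a. lin poly_scale (sym_part a) y) x"

text \<open>The summands of the second component are [s, y], then [x, t] with its sign, then the
  component of [x, y] in the symbol space; the first component is the torus component of
  [x, y].\<close>

definition rep_bracket where
  "rep_bracket s x t y =
    (rep_torus x y, sym_class (torus_act s y - torus_act t x + rep_sym x y))"

definition rep :: "('l \<times> 'g \<Rightarrow>\<^sub>0 'k) set \<Rightarrow> ('l \<times> 'g \<Rightarrow>\<^sub>0 'k)" where
  "rep A = (SOME x. Poly_Mapping.keys x \<subseteq> ext_roots \<and> sym_class x = A)"

text \<open>The value \<open>undefined\<close> off the carrier matches the clause that makes the
  description of \<open>lie_bracket\<close> unique.\<close>

definition br :: "('l, 'g, 'k) hvec \<Rightarrow> ('l, 'g, 'k) hvec \<Rightarrow> ('l, 'g, 'k) hvec" where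
  "br u v = (if u \<in> carrier lie_space \<and> v \<in> carrier lie_space
     then rep_bracket (fst u) (rep (snd u)) (fst v) (rep (snd v)) else undefined)"

text \<open>The structure constants \<epsilon> appear as coefficients of symbols, so the defining
  relation is needed with an arbitrary coefficient.\<close>

lemma single_scale_relation:
  assumes "a \<in> ext_roots"
  shows "Poly_Mapping.single (ext_incl \<zeta> \<otimes>\<^bsub>lattice_ext\<^esub> a) c - Poly_Mapping.single a (\<zeta> * c)
    \<in> sym_relations"
proof -
  have "poly_scale c (Poly_Mapping.single (ext_incl \<zeta> \<otimes>\<^bsub>lattice_ext\<^esub> a) 1 -
      poly_scale \<zeta> (Poly_Mapping.single a 1)) \<in> sym_relations"
    using assms unfolding sym_relations_def by (intro poly.span_scale poly.span_base) blast
  then show ?thesis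
    by (simp add: poly.scale_right_diff_distrib poly_scale_single mult.commute)
qed

text \<open>Both symbols of a relation lie over the same root, so \<open>s\<close> multiplies them
  by the same scalar.\<close>

lemma torus_act_respects_relations:
  assumes "n \<in> sym_relations"
  shows "torus_act s n \<in> sym_relations"
  unfolding torus_act_def
  by (rule lin_mem_of_sym_relations[OF poly.module_axioms sym_relations_subspace assms])
    (simp add: poly_scale_single single_scale_relation)

text \<open>The scalar attached to a pair of lifts gains the factor \<zeta> whenever either lift
  does. Hence the bilinear extension kills relations outright, which is the criterion above for the
  zero subspace.\<close>

lemma rep_torus_cong:
  assumes "Poly_Mapping.keys x' \<subseteq> ext_roots" "Poly_Mapping.keys y \<subseteq> ext_roots"
    and "x - x' \<in> sym_relations" "y - y' \<in> sym_relations"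
  shows "rep_torus x y = rep_torus x' y'"
proof
  fix l
  have "rep_torus x y l - rep_torus x' y' l \<in> {0}"
    unfolding rep_torus_def
    by (rule bilinear_ext_respects_relations[OF scalar.module_axioms scalar.subspace_single_0 _ _ assms])
      (auto simp: torus_part_def ext_scale_left ext_scale_right the_inv_ext_incl_scale
        lattice_ext_closed ext_roots_carrier)
  then show "rep_torus x y l = rep_torus x' y' l" by simp
qed

text \<open>Here equality would be too much to ask: the symbol of \<zeta> times a lift is
  proportional to the original symbol only modulo the relations.\<close>

lemma rep_sym_cong:
  assumes "Poly_Mapping.keys x' \<subseteq> ext_roots" "Poly_Mapping.keys y \<subseteq> ext_roots"
    and "x - x' \<in> sym_relations" "y - y' \<in> sym_relations"
  shows "rep_sym x y - rep_sym x' y' \<in> sym_relations"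
  unfolding rep_sym_def
  by (rule bilinear_ext_respects_relations[OF poly.module_axioms sym_relations_subspace _ _ assms])
    (auto simp: sym_part_def ext_scale_left ext_scale_right poly_scale_single
      poly.subspace_0[OF sym_relations_subspace] intro!: single_scale_relation ext_roots_mult)

lemma rep_bracket_cong:
  assumes "Poly_Mapping.keys x' \<subseteq> ext_roots" "Poly_Mapping.keys y \<subseteq> ext_roots"
    and "sym_class x = sym_class x'" "sym_class y = sym_class y'"
  shows "rep_bracket s x t y = rep_bracket s x' t y'"
proof -
  note rel = assms(3,4)[unfolded sym_class_eq_iff]
  have "torus_act s (y - y') - torus_act t (x - x') + (rep_sym x y - rep_sym x' y')
      \<in> sym_relations"
    using rep_sym_cong[OF assms(1,2) rel] torus_act_respects_relations[OF rel(1)]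
      torus_act_respects_relations[OF rel(2)]
    by (blast intro: poly.subspace_add[OF sym_relations_subspace]
        poly.subspace_diff[OF sym_relations_subspace])
  also have "torus_act s (y - y') - torus_act t (x - x') + (rep_sym x y - rep_sym x' y') =
      torus_act s y - torus_act t x + rep_sym x y - (torus_act s y' - torus_act t x' + rep_sym x' y')"
    by (simp add: torus_act_def lin_diff[OF poly.module_axioms])
  finally show ?thesis
    using rep_torus_cong[OF assms(1,2) rel] by (simp add: rep_bracket_def sym_class_eq_iff)
qed

lemma rep_class:
  assumes "Poly_Mapping.keys x \<subseteq> ext_roots"
  shows "Poly_Mapping.keys (rep (sym_class x)) \<subseteq> ext_roots \<and> sym_class (rep (sym_class x)) = sym_class x"
  unfolding rep_def
  by (rule someI[where P = "\<lambda>y. Poly_Mapping.keys y \<subseteq> ext_roots \<and> sym_class y = sym_class x" and x = x])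
    (simp add: assms)

lemma br_class:
  assumes "s \<in> dual_space" "t \<in> dual_space"
    and "Poly_Mapping.keys x \<subseteq> ext_roots" "Poly_Mapping.keys y \<subseteq> ext_roots"
  shows "br (s, sym_class x) (t, sym_class y) = rep_bracket s x t y"
proof -
  have "br (s, sym_class x) (t, sym_class y) =
      rep_bracket s (rep (sym_class x)) t (rep (sym_class y))"
    using assms by (simp add: br_def sym_class_mem)
  also have "\<dots> = rep_bracket s x t y"
    using assms rep_class[of x] rep_class[of y] by (intro rep_bracket_cong) simp_all
  finally show ?thesis .
qed

lemma rep_bracket_mem:
  assumes "Poly_Mapping.keys x \<subseteq> ext_roots" "Poly_Mapping.keys y \<subseteq> ext_roots"
  shows "rep_bracket s x t y \<in> carrier lie_space"
proof -
  let ?K = "{x. Poly_Mapping.keys x \<subseteq> ext_roots}"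
  note K = poly.module_axioms subspace_keys_subset[of ext_roots]
  have torus: "torus_act s y \<in> ?K" "torus_act t x \<in> ?K"
    unfolding torus_act_def
    by (intro lin_mem_subspace[OF K]; use assms in auto)+
  have sym_part: "sym_part a b \<in> ?K" if "a \<in> ext_roots" "b \<in> ext_roots" for a b
    using ext_roots_mult[OF that] by (simp add: sym_part_def)
  have "rep_sym x y \<in> ?K"
    unfolding rep_sym_def
  proof (intro lin_mem_subspace[OF K])
    fix a b assume "a \<in> Poly_Mapping.keys x" "b \<in> Poly_Mapping.keys y"
    then show "sym_part a b \<in> ?K" using assms by (intro sym_part) auto
  qed
  from poly.subspace_add[OF K(2) poly.subspace_diff[OF K(2) torus] this]
  have "torus_act s y - torus_act t x + rep_sym x y \<in> ?K" .
  moreover have "torus_part a b (l + m) = torus_part a b l + torus_part a b m" for a b l m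
    by (simp add: torus_part_def check_def form_add_right distrib_left)
  then have "additive (rep_torus x y)"
    by (intro additive.intro) (simp only: rep_torus_def lin_fun_add[OF scalar.module_axioms])
  ultimately show ?thesis by (simp add: rep_bracket_def sym_class_mem dual_space_def)
qed

lemma br_closed:
  assumes "u \<in> carrier lie_space" "v \<in> carrier lie_space"
  shows "br u v \<in> carrier lie_space"
  using assms by (elim carrier_cases) (simp only: br_class rep_bracket_mem)

section \<open>Bilinearity of the model, its defining rules, and uniqueness of the bracket\<close>

lemma torus_act_add: "torus_act s (x + y) = torus_act s x + torus_act s y"
  by (simp add: torus_act_def lin_add[OF poly.module_axioms])

lemma torus_act_scale: "torus_act s (poly_scale c x) = poly_scale c (torus_act s x)"
  by (simp add: torus_act_def lin_scale[OF poly.module_axioms])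

lemma torus_act_fun_add: "torus_act (\<lambda>l. s l + t l) x = torus_act s x + torus_act t x"
  by (simp add: torus_act_def single_add lin_fun_add[OF poly.module_axioms])

lemma torus_act_fun_scale: "torus_act (\<lambda>l. c * s l) x = poly_scale c (torus_act s x)"
  by (simp add: torus_act_def lin_fun_scale[OF poly.module_axioms, symmetric] poly_scale_single)

lemma rep_torus_add:
  "rep_torus (x + x') y = (\<lambda>l. rep_torus x y l + rep_torus x' y l)"
  "rep_torus x (y + y') = (\<lambda>l. rep_torus x y l + rep_torus x y' l)"
  by (intro ext; simp only: rep_torus_def lin_add[OF scalar.module_axioms]
      lin_fun_add[OF scalar.module_axioms])+

lemma rep_torus_scale:
  "rep_torus (poly_scale c x) y = (\<lambda>l. c * rep_torus x y l)"
  "rep_torus x (poly_scale c y) = (\<lambda>l. c * rep_torus x y l)"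
  by (intro ext; simp only: rep_torus_def lin_scale[OF scalar.module_axioms]
      lin_fun_scale[OF scalar.module_axioms])+

lemma rep_sym_add:
  "rep_sym (x + x') y = rep_sym x y + rep_sym x' y"
  "rep_sym x (y + y') = rep_sym x y + rep_sym x y'"
  by (simp_all only: rep_sym_def lin_add[OF poly.module_axioms] lin_fun_add[OF poly.module_axioms])

lemma rep_sym_scale:
  "rep_sym (poly_scale c x) y = poly_scale c (rep_sym x y)"
  "rep_sym x (poly_scale c y) = poly_scale c (rep_sym x y)"
  by (simp_all only: rep_sym_def lin_scale[OF poly.module_axioms] lin_fun_scale[OF poly.module_axioms])

text \<open>The torus and symbol parts of an argument must vary together: each contributes its own
  summands, so the formula is linear in the pair but not in either part alone.\<close>

lemma rep_bracket_add:
  "rep_bracket (\<lambda>l. s l + s' l) (x + x') t y =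
    vadd lie_space (rep_bracket s x t y) (rep_bracket s' x' t y)"
  "rep_bracket s x (\<lambda>l. t l + t' l) (y + y') =
    vadd lie_space (rep_bracket s x t y) (rep_bracket s x t' y')"
  unfolding rep_bracket_def lie_space_simps sym_add_class rep_torus_add rep_sym_add
    torus_act_add torus_act_fun_add
  by (intro arg_cong2[of _ _ _ _ Pair] arg_cong[of _ _ sym_class] refl;
      simp only: add_ac diff_conv_add_uminus minus_add_distrib)+

lemma rep_bracket_scale:
  "rep_bracket (\<lambda>l. c * s l) (poly_scale c x) t y = vscale lie_space c (rep_bracket s x t y)"
  "rep_bracket s x (\<lambda>l. c * t l) (poly_scale c y) = vscale lie_space c (rep_bracket s x t y)"
  unfolding rep_bracket_def lie_space_simps sym_scale_class rep_torus_scale rep_sym_scale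
    torus_act_scale torus_act_fun_scale
  by (simp_all only: poly.scale_right_distrib poly.scale_right_diff_distrib)

lemma br_add:
  assumes "u \<in> carrier lie_space" "v \<in> carrier lie_space" "v' \<in> carrier lie_space"
  shows "br u (vadd lie_space v v') = vadd lie_space (br u v) (br u v')"
    and "br (vadd lie_space v v') u = vadd lie_space (br v u) (br v' u)"
  using assms
  by (elim carrier_cases; simp only: lie_space_simps sym_add_class br_class dual_space_closed
      keys_add_subset rep_bracket_add simp_thms)+

lemma br_scale:
  assumes "u \<in> carrier lie_space" "v \<in> carrier lie_space"
  shows "br u (vscale lie_space c v) = vscale lie_space c (br u v)"
    and "br (vscale lie_space c v) u = vscale lie_space c (br v u)"
  using assms
  by (elim carrier_cases; simp only: lie_space_simps sym_scale_class br_class dual_space_closed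
      keys_scale_subset rep_bracket_scale simp_thms)+

lemma br_bilinear: "bilinear_op lie_space br"
  unfolding bilinear_op_def linear_endo_def
  by (intro conjI ballI allI funcsetI br_add br_scale br_closed; assumption)

lemma br_is_lie_bracket: "is_lie_bracket br"
proof -
  have 1: "br (in_t s) (in_t t) = in_t (\<lambda>_. 0)" if "s \<in> dual_space" "t \<in> dual_space" for s t
    using that by (simp add: in_t_def br_class) (simp add: rep_bracket_def rep_torus_def[abs_def]
      rep_sym_def torus_act_def)
  note lin1 = lin_single[OF poly.module_axioms] lin_single[OF scalar.module_axioms]
  have 2: "br (in_t (check \<alpha>)) (in_l (X b)) = vscale lie_space (of_int (form \<alpha> (fst b))) (in_l (X b))"
    if "b \<in> ext_roots" for \<alpha> b
    using that by (simp add: in_t_def in_l_def X_def br_class dual_space_closed sym_scale_class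
      poly_scale_single)
      (simp add: rep_bracket_def rep_torus_def[abs_def] rep_sym_def torus_act_def lin1 check_def
        poly_scale_single)
  have 3: "br (in_l (X b)) (in_t (check \<alpha>)) = vscale lie_space (- of_int (form \<alpha> (fst b))) (in_l (X b))"
    if "b \<in> ext_roots" for \<alpha> b
    using that by (simp add: in_t_def in_l_def X_def br_class dual_space_closed sym_scale_class
      poly_scale_single)
      (simp add: rep_bracket_def rep_torus_def[abs_def] rep_sym_def torus_act_def lin1 check_def
        poly_scale_single single_uminus)
  have 4: "br (in_l (X a)) (in_l (X b)) =
        (if fst a + fst b = 0 then
           vscale lie_space
             (\<epsilon> (fst a) (fst b) * the_inv_into \<mu> ext_incl (a \<otimes>\<^bsub>lattice_ext\<^esub> b))
             (in_t (check (fst a)))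
         else if fst a + fst b \<in> roots then
           vscale lie_space (\<epsilon> (fst a) (fst b)) (in_l (X (a \<otimes>\<^bsub>lattice_ext\<^esub> b)))
         else in_t (\<lambda>_. 0))"
    if "a \<in> ext_roots" "b \<in> ext_roots" for a b
  proof -
    \<comment> \<open>This makes the conditions in \<open>torus_part\<close> and
      \<open>sym_part\<close> exclusive, so at most one component survives in each case of the
      rule.\<close>
    have "0 \<notin> roots" by (simp add: roots_def)
    have "br (in_l (X a)) (in_l (X b)) = (torus_part a b, sym_class (sym_part a b))"
      using that by (simp add: in_l_def X_def br_class dual_space_closed)
        (simp add: rep_bracket_def rep_torus_def[abs_def] rep_sym_def torus_act_def lin1)
    then show ?thesis using \<open>0 \<notin> roots\<close>
      by (simp add: in_t_def in_l_def X_def torus_part_def[abs_def] sym_part_def sym_scale_class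
          poly_scale_single)
  qed
  show ?thesis
    unfolding is_lie_bracket_def
    by (intro conjI ballI) (rule br_bilinear 1 2 3 4; assumption)+
qed

lemma is_lie_bracketD:
  assumes "is_lie_bracket B"
  shows "s \<in> dual_space \<Longrightarrow> t \<in> dual_space \<Longrightarrow> B (in_t s) (in_t t) = in_t (\<lambda>_. 0)"
    and "\<alpha> \<in> roots \<Longrightarrow> b \<in> ext_roots \<Longrightarrow> B (in_t (check \<alpha>)) (in_l (X b)) =
      vscale lie_space (of_int (form \<alpha> (fst b))) (in_l (X b))"
    and "\<alpha> \<in> roots \<Longrightarrow> b \<in> ext_roots \<Longrightarrow> B (in_l (X b)) (in_t (check \<alpha>)) =
      vscale lie_space (- of_int (form \<alpha> (fst b))) (in_l (X b))"
    and "a \<in> ext_roots \<Longrightarrow> b \<in> ext_roots \<Longrightarrow> B (in_l (X a)) (in_l (X b)) =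
      (if fst a + fst b = 0 then
         vscale lie_space
           (\<epsilon> (fst a) (fst b) * the_inv_into \<mu> ext_incl (a \<otimes>\<^bsub>lattice_ext\<^esub> b))
           (in_t (check (fst a)))
       else if fst a + fst b \<in> roots then
         vscale lie_space (\<epsilon> (fst a) (fst b)) (in_l (X (a \<otimes>\<^bsub>lattice_ext\<^esub> b)))
       else in_t (\<lambda>_. 0))"
proof -
  note B = assms[unfolded is_lie_bracket_def, THEN conjunct2]
  note tl = B[THEN conjunct2, THEN conjunct1, THEN bspec, THEN bspec]
  show "s \<in> dual_space \<Longrightarrow> t \<in> dual_space \<Longrightarrow> B (in_t s) (in_t t) = in_t (\<lambda>_. 0)"
    by (rule B[THEN conjunct1, THEN bspec, THEN bspec])
  show "\<alpha> \<in> roots \<Longrightarrow> b \<in> ext_roots \<Longrightarrow> B (in_t (check \<alpha>)) (in_l (X b)) =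
      vscale lie_space (of_int (form \<alpha> (fst b))) (in_l (X b))"
    by (rule tl[THEN conjunct1])
  show "\<alpha> \<in> roots \<Longrightarrow> b \<in> ext_roots \<Longrightarrow> B (in_l (X b)) (in_t (check \<alpha>)) =
      vscale lie_space (- of_int (form \<alpha> (fst b))) (in_l (X b))"
    by (rule tl[THEN conjunct2])
qed (rule assms[unfolded is_lie_bracket_def, THEN conjunct2, THEN conjunct2, THEN conjunct2,
    THEN bspec, THEN bspec])

lemma gens_cases:
  assumes "u \<in> gens"
  obtains \<alpha> where "\<alpha> \<in> roots" "u = in_t (check \<alpha>)" | a where "a \<in> ext_roots" "u = in_l (X a)"
  using assms unfolding gens_def by auto

lemma is_lie_bracket_unique:
  assumes B: "is_lie_bracket B" and C: "is_lie_bracket C"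
    and "u \<in> carrier lie_space" "v \<in> carrier lie_space"
  shows "B u v = C u v"
proof (rule bilinear_op_eqI[OF _ _ _ assms(3,4)])
  fix u v assume "u \<in> gens" "v \<in> gens"
  then show "B u v = C u v"
    by (elim gens_cases; simp only: check_mem is_lie_bracketD[OF B] is_lie_bracketD[OF C])
qed (use B C in \<open>simp_all only: is_lie_bracket_def\<close>)

text \<open>The model supplies existence. Two candidates agree on the carrier by their values on
  generators, and off it because both are \<open>undefined\<close>. From here on the bracket is
  known only through the rules of \<open>is_lie_bracket\<close>.\<close>

lemma lie_bracket_is_lie_bracket: "is_lie_bracket lie_bracket"
proof -
  have "lie_bracket = br"
    unfolding lie_bracket_def
  proof (rule the_equality)
    show "is_lie_bracket br \<and>
        (\<forall>u v. u \<notin> carrier lie_space \<or> v \<notin> carrier lie_space \<longrightarrow> br u v = undefined)"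
      using br_is_lie_bracket by (auto simp: br_def)
    fix B assume "is_lie_bracket B \<and>
        (\<forall>u v. u \<notin> carrier lie_space \<or> v \<notin> carrier lie_space \<longrightarrow> B u v = undefined)"
    then have B: "is_lie_bracket B"
      and outside: "u \<notin> carrier lie_space \<or> v \<notin> carrier lie_space \<Longrightarrow> B u v = undefined" for u v
      by blast+
    show "B = br"
    proof (intro ext)
      fix u v
      show "B u v = br u v"
      proof (cases "u \<in> carrier lie_space \<and> v \<in> carrier lie_space")
        case True
        then show ?thesis using is_lie_bracket_unique[OF B br_is_lie_bracket] by blast
      next
        case False
        then have "br u v = undefined" unfolding br_def by (rule if_not_P)
        then show ?thesis using outside False by metis
      qed
    qed
  qed
  then show ?thesis using br_is_lie_bracket by simp
qed

end

lemma linear_endo_funpow: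
  assumes "linear_endo V f"
  shows "linear_endo V (f ^^ n)"
proof (induction n)
  case 0
  then show ?case by (simp add: linear_endo_def)
next
  case (Suc n)
  from linear_endo_comp[OF assms this] show ?case by (simp add: comp_def)
qed

section \<open>The lift of w: existence, bijectivity, compatibility with the bracket\<close>

context input_datum
begin

lemma lie_algebra_simps:
  "carrier lie_algebra = carrier lie_space" "vadd lie_algebra = vadd lie_space"
  "vscale lie_algebra = vscale lie_space" "bracket lie_algebra = lie_bracket"
  by (simp_all add: lie_algebra_def vec_space.defs lie_alg.defs)

lemma linear_endo_lie_algebra: "linear_endo lie_algebra = linear_endo lie_space"
  by (intro ext) (simp only: linear_endo_def lie_algebra_simps)

lemma linear_endo_vscale:
  "linear_endo lie_space f \<Longrightarrow> v \<in> carrier lie_space \<Longrightarrow>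
    f (vscale lie_space c v) = vscale lie_space c (f v)"
  unfolding linear_endo_def by blast

definition push_w :: "('l \<times> 'g \<Rightarrow>\<^sub>0 'k) \<Rightarrow> ('l \<times> 'g \<Rightarrow>\<^sub>0 'k)" where
  "push_w = lin poly_scale (\<lambda>a. Poly_Mapping.single (w_ext a) 1)"

text \<open>Composing with the inverse of \<open>w\<close> sends \<open>check \<alpha>\<close> to
  \<open>check (w \<alpha>)\<close>, because \<open>w\<close> preserves the form. The restriction
  puts the map among the extensional ones, where uniqueness is claimed.\<close>

definition w_lift :: "('l, 'g, 'k) hvec \<Rightarrow> ('l, 'g, 'k) hvec" where
  "w_lift = restrict (\<lambda>v. (\<lambda>l. fst v (inv_into UNIV w l), sym_class (push_w (rep (snd v)))))
    (carrier lie_space)"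

lemma push_w_single: "push_w (Poly_Mapping.single a c) = Poly_Mapping.single (w_ext a) c"
  by (simp add: push_w_def lin_single[OF poly.module_axioms] poly_scale_single)

lemma push_w_linear:
  "push_w (x + y) = push_w x + push_w y" "push_w (x - y) = push_w x - push_w y"
  "push_w (poly_scale c x) = poly_scale c (push_w x)"
  by (simp_all only: push_w_def lin_add[OF poly.module_axioms] lin_diff[OF poly.module_axioms]
      lin_scale[OF poly.module_axioms])

text \<open>Since \<open>w_ext\<close> is multiplicative and fixes the central elements, it carries
  the relation at \<open>a\<close> to the relation at \<open>w_ext a\<close>.\<close>

lemma push_w_relations:
  assumes "n \<in> sym_relations"
  shows "push_w n \<in> sym_relations"
  unfolding push_w_def
proof (rule lin_mem_of_sym_relations[OF poly.module_axioms sym_relations_subspace assms])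
  fix a :: "'l \<times> 'g" assume "a \<in> ext_roots"
  then have "w_ext a \<in> ext_roots" by simp
  from single_scale_relation[OF this, of 1]
  show "Poly_Mapping.single (w_ext (ext_incl \<zeta> \<otimes>\<^bsub>lattice_ext\<^esub> a)) 1 -
      poly_scale \<zeta> (Poly_Mapping.single (w_ext a) 1) \<in> sym_relations"
    by (simp only: w_ext_mult w_ext_incl poly_scale_single)
qed

lemma push_w_keys:
  assumes "Poly_Mapping.keys x \<subseteq> ext_roots"
  shows "Poly_Mapping.keys (push_w x) \<subseteq> ext_roots"
proof -
  have "push_w x \<in> {x. Poly_Mapping.keys x \<subseteq> ext_roots}"
    unfolding push_w_def
  proof (rule lin_mem_subspace[OF poly.module_axioms subspace_keys_subset])
    fix a assume "a \<in> Poly_Mapping.keys x"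
    then have "w_ext a \<in> ext_roots" using assms by auto
    then show "Poly_Mapping.single (w_ext a) 1 \<in> {x. Poly_Mapping.keys x \<subseteq> ext_roots}" by simp
  qed
  then show ?thesis by simp
qed

lemma w_lift_class:
  assumes "s \<in> dual_space" "Poly_Mapping.keys x \<subseteq> ext_roots"
  shows "w_lift (s, sym_class x) = (\<lambda>l. s (inv_into UNIV w l), sym_class (push_w x))"
proof -
  have "sym_class (rep (sym_class x)) = sym_class x" using rep_class[OF assms(2)] by blast
  then have "push_w (rep (sym_class x) - x) \<in> sym_relations"
    unfolding sym_class_eq_iff by (rule push_w_relations)
  then have "sym_class (push_w (rep (sym_class x))) = sym_class (push_w x)"
    by (simp only: sym_class_eq_iff push_w_linear)
  then show ?thesis using assms by (simp add: w_lift_def sym_class_mem)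
qed

lemma inv_w_add: "inv_into UNIV w (x + y) = inv_into UNIV w x + inv_into UNIV w y"
proof -
  have "w (inv_into UNIV w x + inv_into UNIV w y) = x + y"
    by (simp only: w_add surj_f_inv_f[OF bij_is_surj[OF bij_w]])
  then show ?thesis using inv_f_f[OF bij_is_inj[OF bij_w]] by metis
qed

lemma dual_space_inv_w:
  assumes "s \<in> dual_space"
  shows "(\<lambda>l. s (inv_into UNIV w l)) \<in> dual_space"
  using assms by (simp add: dual_space_def additive_def inv_w_add)

lemma w_lift_linear: "linear_endo lie_space w_lift"
  unfolding linear_endo_def
proof (intro conjI ballI allI funcsetI)
  fix u v c assume "u \<in> carrier lie_space" "v \<in> carrier lie_space"
  then show "w_lift (vadd lie_space u v) = vadd lie_space (w_lift u) (w_lift v)"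
    by (elim carrier_cases; simp only: lie_space_simps sym_add_class w_lift_class dual_space_closed
        keys_add_subset push_w_linear)
next
  fix v c assume "v \<in> carrier lie_space"
  then show "w_lift (vscale lie_space c v) = vscale lie_space c (w_lift v)"
    by (elim carrier_cases; simp only: lie_space_simps sym_scale_class w_lift_class
        dual_space_closed keys_scale_subset push_w_linear)
next
  fix v assume "v \<in> carrier lie_space"
  then show "w_lift v \<in> carrier lie_space"
    by (elim carrier_cases; simp only: w_lift_class lie_space_simps mem_Times_iff fst_conv snd_conv
        dual_space_inv_w sym_class_mem push_w_keys simp_thms)
qed

lemma w_lift_extends_w: "extends_w w_lift"
  unfolding extends_w_def linear_endo_lie_algebra
proof (intro conjI ballI w_lift_linear)
  fix \<alpha>
  have "form \<alpha> (inv_into UNIV w l) = form (w \<alpha>) l" for l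
    using form_w[of \<alpha> "inv_into UNIV w l"] by (simp add: surj_f_inv_f[OF bij_is_surj[OF bij_w]])
  then show "w_lift (in_t (check \<alpha>)) = in_t (check (w \<alpha>))"
    by (simp add: in_t_def w_lift_class push_w_def) (simp add: check_def)
next
  fix a assume "a \<in> ext_roots"
  then show "w_lift (in_l (X a)) = in_l (X (w_ext a))"
    by (simp add: in_l_def X_def w_lift_class dual_space_closed push_w_single)
qed

lemma extends_wD:
  assumes "extends_w f"
  shows "linear_endo lie_space f"
    and "\<alpha> \<in> roots \<Longrightarrow> f (in_t (check \<alpha>)) = in_t (check (w \<alpha>))"
    and "a \<in> ext_roots \<Longrightarrow> f (in_l (X a)) = in_l (X (w_ext a))"
  using assms unfolding extends_w_def linear_endo_lie_algebra by blast+

lemma extends_w_unique: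
  assumes "extends_w f" "extends_w g" "v \<in> carrier lie_space"
  shows "f v = g v"
proof (rule linear_endo_eqI[OF extends_wD(1)[OF assms(1)] extends_wD(1)[OF assms(2)] _ assms(3)])
  fix u assume "u \<in> gens"
  then show "f u = g u"
    by (elim gens_cases; simp only: extends_wD[OF assms(1)] extends_wD[OF assms(2)])
qed

lemma extends_w_bij:
  assumes "extends_w f"
  shows "bij_betw f (carrier lie_space) (carrier lie_space)"
proof -
  note f = extends_wD[OF assms]
  have root: "(w ^^ n) \<alpha> \<in> roots" if "\<alpha> \<in> roots" for n \<alpha>
    using that by (induction n) simp_all
  have ext_root: "(w_ext ^^ n) a \<in> ext_roots" if "a \<in> ext_roots" for n a
    using that by (induction n) simp_all
  have t: "(f ^^ n) (in_t (check \<alpha>)) = in_t (check ((w ^^ n) \<alpha>))" if "\<alpha> \<in> roots" for n \<alpha>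
    by (induction n) (simp_all add: f(2) root[OF that])
  have l: "(f ^^ n) (in_l (X a)) = in_l (X ((w_ext ^^ n) a))" if "a \<in> ext_roots" for n a
    by (induction n) (simp_all add: f(3) ext_root[OF that])
  have id: "(f ^^ d) v = v" if "v \<in> carrier lie_space" for v
  proof (rule linear_endo_eqI[OF linear_endo_funpow[OF f(1)] _ _ that])
    show "linear_endo lie_space (\<lambda>v. v)" by (simp add: linear_endo_def del: lie_space_simps)
    fix u assume "u \<in> gens"
    then show "(f ^^ d) u = u"
      by (elim gens_cases) (simp_all add: t l w_ext_funpow w_order(2))
  qed
  \<comment> \<open>The inverse is the iterate with exponent d - 1, which exists because
    \<open>d\<close> is positive. The two unfoldings below peel one factor \<open>f\<close> off
    either end of the d-th iterate.\<close>
  obtain n where n: "d = Suc n" using w_order(1) gr0_conv_Suc by blast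
  show ?thesis
  proof (rule bij_betw_byWitness[where f' = "f ^^ n"])
    show "\<forall>v\<in>carrier lie_space. (f ^^ n) (f v) = v"
      using id unfolding n funpow_Suc_right comp_apply by blast
    show "\<forall>v\<in>carrier lie_space. f ((f ^^ n) v) = v"
      using id unfolding n funpow.simps comp_apply by blast
  qed (use linear_endo_closed[OF f(1)] linear_endo_closed[OF linear_endo_funpow[OF f(1)]] in blast)+
qed

lemma extends_w_bracket:
  assumes "extends_w f" and u: "u \<in> carrier lie_space" and v: "v \<in> carrier lie_space"
  shows "f (lie_bracket u v) = lie_bracket (f u) (f v)"
proof -
  note f = extends_wD[OF assms(1)]
  note B = is_lie_bracketD[OF lie_bracket_is_lie_bracket]
  have lin: "linear_endo lie_space (lie_bracket u)" "linear_endo lie_space (\<lambda>v. lie_bracket v u)"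
    if "u \<in> carrier lie_space" for u
    using lie_bracket_is_lie_bracket that unfolding is_lie_bracket_def bilinear_op_def by blast+
  note scale = linear_endo_vscale[OF f(1)]
  show ?thesis
  proof (rule bilinear_op_eqI[OF _ _ _ u v])
    show "bilinear_op lie_space (\<lambda>u v. f (lie_bracket u v))"
      unfolding bilinear_op_def by (intro conjI ballI linear_endo_comp[OF f(1)] lin)
    show "bilinear_op lie_space (\<lambda>u v. lie_bracket (f u) (f v))"
      unfolding bilinear_op_def
      using linear_endo_comp[OF lin(1) f(1)] linear_endo_comp[OF lin(2) f(1)]
        linear_endo_closed[OF f(1)]
      by blast
    fix u v assume "u \<in> gens" "v \<in> gens"
    then show "f (lie_bracket u v) = lie_bracket (f u) (f v)"
    proof (elim gens_cases)
      fix \<alpha> \<beta> assume *: "\<alpha> \<in> roots" "\<beta> \<in> roots" "u = in_t (check \<alpha>)" "v = in_t (check \<beta>)"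
      then show ?thesis by (simp only: f B check_mem linear_endo_zero[OF f(1)])
    next
      fix \<alpha> b assume *: "\<alpha> \<in> roots" "b \<in> ext_roots" "u = in_t (check \<alpha>)" "v = in_l (X b)"
      then show ?thesis
        by (simp only: f B scale gens_mem in_l_X_gens w_root_iff w_ext_root_iff fst_w_ext form_w)
    next
      fix a \<beta> assume *: "\<beta> \<in> roots" "a \<in> ext_roots" "v = in_t (check \<beta>)" "u = in_l (X a)"
      then show ?thesis
        by (simp only: f B scale gens_mem in_l_X_gens w_root_iff w_ext_root_iff fst_w_ext form_w)
    next
      fix a b assume a: "a \<in> ext_roots" "u = in_l (X a)" and b: "b \<in> ext_roots" "v = in_l (X b)"
      \<comment> \<open>Injectivity of \<open>w\<close> and invariance of the set of roots put the
        pair and its image into the same case of the bracket rule.\<close>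
      have "w (fst a) + w (fst b) = 0 \<longleftrightarrow> fst a + fst b = 0"
        using bij_is_inj[OF bij_w] w_zero by (metis w_add inj_eq)
      \<comment> \<open>The product lies over 0, which \<open>w\<close> fixes, and its
        \<open>H\<close> component does not move; so the two scalars coincide.\<close>
      moreover have "w_ext a \<otimes>\<^bsub>lattice_ext\<^esub> w_ext b = a \<otimes>\<^bsub>lattice_ext\<^esub> b"
        if "fst a + fst b = 0"
        using that by (simp add: lattice_ext_mult flip: w_add)
      moreover have "w (fst a) + w (fst b) \<in> roots \<longleftrightarrow> fst a + fst b \<in> roots"
        by (simp flip: w_add)
      moreover have "fst a \<in> roots" using a by (simp add: ext_roots_def)
      moreover have "f (in_l (X (a \<otimes>\<^bsub>lattice_ext\<^esub> b))) =
          in_l (X (w_ext a \<otimes>\<^bsub>lattice_ext\<^esub> w_ext b))" if "fst a + fst b \<in> roots"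
        using f(3)[OF ext_roots_mult[OF a(1) b(1) that]] by (simp only: w_ext_mult)
      moreover have "in_l (X (a \<otimes>\<^bsub>lattice_ext\<^esub> b)) \<in> carrier lie_space"
        if "fst a + fst b \<in> roots"
        by (rule gens_mem[OF in_l_X_gens[OF ext_roots_mult[OF a(1) b(1) that]]])
      ultimately show ?thesis
        by (simp only: a b f(2,3) B w_ext_root_iff fst_w_ext \<epsilon>_w scale in_t_mem[OF check_mem]
            linear_endo_zero[OF f(1)] if_distrib[of f] cong: if_cong)
    qed
  qed
qed

lemma extends_w_lie_automorphism:
  assumes "extends_w f"
  shows "lie_automorphism lie_algebra f"
  unfolding lie_automorphism_def linear_endo_lie_algebra lie_algebra_simps
  using extends_wD(1)[OF assms] extends_w_bij[OF assms] extends_w_bracket[OF assms] by blast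

text \<open>Off the carrier \<open>extends_w\<close> says nothing, so uniqueness can hold only once
  the values there are fixed by extensionality.\<close>

lemma ex1_extends_w: "\<exists>!f. f \<in> extensional (carrier lie_algebra) \<and> extends_w f"
proof (rule ex1I[of _ w_lift])
  show "w_lift \<in> extensional (carrier lie_algebra) \<and> extends_w w_lift"
    unfolding lie_algebra_simps
    by (intro conjI w_lift_extends_w) (simp only: w_lift_def restrict_extensional)
  fix f assume "f \<in> extensional (carrier lie_algebra) \<and> extends_w f"
  then have f: "f \<in> extensional (carrier lie_space)" "extends_w f"
    by (simp_all only: lie_algebra_simps simp_thms)
  show "f = w_lift"
  proof (rule extensionalityI[OF f(1)])
    show "w_lift \<in> extensional (carrier lie_space)"
      by (simp only: w_lift_def restrict_extensional)
    fix v assume "v \<in> carrier lie_space"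
    then show "f v = w_lift v" by (rule extends_w_unique[OF f(2) w_lift_extends_w])
  qed
qed

end
theorem proposition2p4:
  fixes smul :: "int \<Rightarrow> 'l::ab_group_add \<Rightarrow> 'l" and form :: "'l \<Rightarrow> 'l \<Rightarrow> int"
    and w :: "'l \<Rightarrow> 'l" and d :: nat and \<zeta> :: "'k::field_char_0"
    and H :: "('g, 'x) monoid_scheme" and \<iota> :: "'k \<Rightarrow> 'g" and \<pi> :: "'g \<Rightarrow> 'l set"
    and \<epsilon> :: "'l \<Rightarrow> 'l \<Rightarrow> 'k"
  assumes "input_datum smul form w d \<zeta> H \<iota> \<pi> \<epsilon>"
  shows "(\<exists>!f. f \<in> extensional (carrier (input_datum.lie_algebra form w \<zeta> H \<iota> \<pi> \<epsilon>)) \<and>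
            input_datum.extends_w form w \<zeta> H \<iota> \<pi> \<epsilon> f) \<and>
         (\<forall>f. input_datum.extends_w form w \<zeta> H \<iota> \<pi> \<epsilon> f \<longrightarrow>
            lie_automorphism (input_datum.lie_algebra form w \<zeta> H \<iota> \<pi> \<epsilon>) f)"
  using assms
  by (intro conjI allI impI input_datum.ex1_extends_w input_datum.extends_w_lie_automorphism)

end
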